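(* Let $S(t)$ be an asymptotically compact semiflow on a complete metric space $X$, let $\mathscr{A}$ be an attractor of $S(t)$ with attraction basin $\Omega=\Omega(\mathscr{A})$, and let $\mathcal{M}=\{M_1,\dots,M_l\}$ be a Morse decomposition of $\mathscr{A}$ with Morse filtration $\emptyset=A_0\subsetneq A_1\subsetneq\cdots\subsetneq A_l=\mathscr{A}$. Let $1\le k\le l$, and let $W_k\subset\Omega(A_k)$ and $W_{k-1}\subset\Omega(A_{k-1})$ be any positively invariant neighborhoods of $A_k$ and $A_{k-1}$, respectively. Then $$C_q(M_k)\cong H_q(W_k,W_{k-1}),\qquad q=0,1,2,\dots,$$ where $C_*(M_k)$ is the critical group of the Morse set $M_k$.
   Context: $H_*$ denotes singular homology with coefficients in a given abelian group $\mathscr{G}$. $(X,d)$ is a complete metric space. $C(U)$ denotes the continuous real-valued functions on $U$. A semiflow on $X$ is a continuous map $S:[0,\infty)\times X\to X$, written $S(t)x=S(t,x)$, with $S(0)x=x$ and $S(t+s)x=S(t)S(s)x$ for all $t,s\ge 0$, $x\in X$. It is asymptotically compact if, whenever $(x_n)$ is a bounded sequence in $X$, $t_n\to+\infty$ and $(S(t_n)x_n)$ is bounded, the sequence $(S(t_n)x_n)$ has a convergent subsequence. For $A\subset X$ and $\varepsilon>0$, $B(A,\varepsilon)=\{y\in X: d(y,A)<\varepsilon\}$. A set $U$ is a neighborhood of $A$ if $\overline{A}\subset\operatorname{int}U$. $A$ attracts $B\subset X$ if for every $\varepsilon>0$ there is $T>0$ with $S(t)B\subset B(A,\varepsilon)$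 for all $t>T$. $A$ is invariant (resp. positively invariant) if $S(t)A=A$ (resp. $S(t)A\subset A$) for all $t\ge0$. An attractor is a compact invariant set that attracts some neighborhood of itself. The attraction basin of $A$ is $\Omega(A)=\{x: \lim_{t\to\infty}d(S(t)x,A)=0\}$ (an open set when $A$ is an attractor); $\Omega(\emptyset)=\emptyset$. Morse decompositions: let $\mathscr{A}$ be an attractor. A compact set $A\subset\mathscr{A}$ is an attractor of $S(t)$ in $\mathscr{A}$ if it is an attractor of the restriction of $S(t)$ to $\mathscr{A}$ (the empty set is allowed); such a set is then also an attractor of $S(t)$ in $X$. Its dual repeller is $A^*=\{x\in\mathscr{A}:\omega(x)\cap A=\emptyset\}$, where $\omega(x)=\{y:\exists\,t_n\to+\infty,\ S(t_n)x\to y\}$. An ordered collection $\mathcal{M}=\{M_1,\dots,M_l\}$ of subsets of $\mathscr{A}$ is a Morse decomposition of $\mathscr{A}$, with Morse sets $M_k$, if there is a strictly increasing sequence $\emptyset=A_0\subsetneq A_1\subsetneq\cdots\subsetneq A_l=\mathscr{A}$ of attractors of $S(t)$ in $\mathscr{A}$ (the Morse filtration) such that $M_k=A_k\cap A_{k-1}^*$ for $1\le k\le l$. Put $\mathcal{R}=\bigcup_{1\le k\le l}M_k$. A function $V\in C(\Omega)$ is a Morse-Lyapunov function of $\mathcal{M}$ on $\Omega$ if (1) $V$ is constant on each $M_k$ and (2) $t\mapsto V(S(t)x)$ is strictly decreasing in $t$ for each $x\in\Omega\setminus\mathcal{R}$. It is strict if in addition $V(M_1)<V(M_2)<\cdots<V(M_l)$,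 where $V(M_k)$ is the constant value of $V$ on $M_k$. The generalized critical values of $V$ are the numbers $c_k=V(M_k)$, $1\le k\le l$. For $a\in\mathbb{R}$, $V_a=\{x\in\Omega: V(x)\le a\}$. Critical groups: let $V$ be a strict Morse-Lyapunov function of $\mathcal{M}$ and let $a<c_k<b$ be such that $c_k$ is the unique generalized critical value of $V$ in $[a,b]$. The critical group $C_*(M_k)$ is defined by $C_q(M_k)=H_q(V_b,V_a)$, $q=0,1,2,\dots$; up to isomorphism it does not depend on the choice of $a,b$ or of $V$. *)

theory Defs
  imports "HOL-Analysis.Analysis" "HOL-Homology.Homology"
begin

text \<open>
  Relative singular homology with coefficients in an arbitrary abelian group \<open>'g\<close>.  The library
  treats integer coefficients only.  The definitions below are those of
  \<open>HOL-Homology.Simplices\<close> and \<open>HOL-Homology.Homology_Groups\<close> with \<open>int\<close>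
  replaced by \<open>'g\<close>, on the library's own singular simplices and faces; a formal sum
  \<open>g\<^sub>1 f\<^sub>1 + \<dots> + g\<^sub>n f\<^sub>n\<close> is a finitely supported function from simplices to \<open>'g\<close>.
  As in the library, the pair \<open>(X, T)\<close> is read as \<open>(X, X \<inter> T)\<close> when \<open>T\<close> is not
  a subset of the space \<open>X\<close>.
\<close>

type_synonym ('a, 'g) coeff_chain = "((nat \<Rightarrow> real) \<Rightarrow> 'a) \<Rightarrow>\<^sub>0 'g"

definition coeff_singular_chain :: "nat \<Rightarrow> 'a topology \<Rightarrow> ('a, 'g::ab_group_add) coeff_chain \<Rightarrow> bool"
  where "coeff_singular_chain p X c \<longleftrightarrow> Poly_Mapping.keys c \<subseteq> singular_simplex_set p X"

definition coeff_boundary :: "nat \<Rightarrow> ('a, 'g::ab_group_add) coeff_chain \<Rightarrow> ('a, 'g) coeff_chain"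
  where "coeff_boundary p c =
    (if p = 0 then 0
     else \<Sum>f\<in>Poly_Mapping.keys c. \<Sum>k\<le>p.
       Poly_Mapping.single (singular_face p k f)
         (if even k then Poly_Mapping.lookup c f else - Poly_Mapping.lookup c f))"

definition coeff_relcycles ::
    "nat \<Rightarrow> 'a topology \<Rightarrow> 'a set \<Rightarrow> ('a, 'g::ab_group_add) coeff_chain set"
  where "coeff_relcycles p X T =
    {c. coeff_singular_chain p X c \<and>
        coeff_singular_chain (p - 1) (subtopology X T) (coeff_boundary p c)}"

definition coeff_relboundaries ::
    "nat \<Rightarrow> 'a topology \<Rightarrow> 'a set \<Rightarrow> ('a, 'g::ab_group_add) coeff_chain set"
  where "coeff_relboundaries p X T =
    {c. \<exists>d. coeff_singular_chain (Suc p) X d \<and>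
            coeff_singular_chain p (subtopology X T) (coeff_boundary (Suc p) d - c)}"

definition coeff_relcycle_group ::
    "nat \<Rightarrow> 'a topology \<Rightarrow> 'a set \<Rightarrow> ('a, 'g::ab_group_add) coeff_chain monoid"
  where "coeff_relcycle_group p X T = \<lparr>carrier = coeff_relcycles p X T, mult = (+), one = 0\<rparr>"

definition coeff_homology_group ::
    "'g::ab_group_add itself \<Rightarrow> nat \<Rightarrow> 'a topology \<Rightarrow> 'a set \<Rightarrow> ('a, 'g) coeff_chain set monoid"
  where "coeff_homology_group G p X T =
    coeff_relcycle_group p X T Mod coeff_relboundaries p X T"

text \<open>For integer coefficients this is literally the library's relative homology group.\<close>

lemma coeff_boundary_int: "coeff_boundary p c = chain_boundary p c"
proof -
  have "frag_cmul z (frag_cmul ((-1)^k) (frag_of x)) = Poly_Mapping.single x (if even k then z else - z)" for z k and x::"(nat\<Rightarrow>real)\<Rightarrow>'a"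
    by (auto intro!: poly_mapping_eqI simp: lookup_single when_def)
  then show ?thesis
    by (simp add: coeff_boundary_def chain_boundary_def frag_extend_def frag_cmul_sum)
qed

lemma coeff_relcycles_int: 
  "coeff_relcycles p X T = singular_relcycle_set p X T"
  "coeff_relboundaries p X T = singular_relboundary_set p X T"
  by (auto simp: coeff_relcycles_def coeff_relboundaries_def coeff_singular_chain_def coeff_boundary_int singular_relcycle_def singular_relboundary_def mod_subset_def singular_chain_def)

lemma coeff_homology_group_int:
  "coeff_homology_group TYPE(int) p X T = relative_homology_group (int p) X T"
proof -
  have "coeff_relcycle_group p X T = relcycle_group p X T"
    unfolding coeff_relcycle_group_def coeff_relcycles_int
    by (rule monoid.equality) auto
  then show ?thesis
    by (simp add: coeff_homology_group_def relative_homology_group_def coeff_relcycles_int)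
qed

definition semiflow :: "(real \<Rightarrow> 'a::metric_space \<Rightarrow> 'a) \<Rightarrow> bool"
  where "semiflow S \<longleftrightarrow>
    continuous_on ({0..} \<times> UNIV) (\<lambda>(t, x). S t x) \<and>
    (\<forall>x. S 0 x = x) \<and>
    (\<forall>t\<ge>0. \<forall>s\<ge>0. \<forall>x. S (t + s) x = S t (S s x))"

definition asymptotically_compact :: "(real \<Rightarrow> 'a::metric_space \<Rightarrow> 'a) \<Rightarrow> bool"
  where "asymptotically_compact S \<longleftrightarrow>
    (\<forall>x t. bounded (range x) \<and> (\<forall>n::nat. t n \<ge> 0) \<and> filterlim t at_top sequentially \<and>
           bounded (range (\<lambda>n. S (t n) (x n))) \<longrightarrow>
       (\<exists>r y. strict_mono r \<and> (\<lambda>n. S (t (r n)) (x (r n))) \<longlonglongrightarrow> y))"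

text \<open>The library sets \<open>infdist x {} = 0\<close>, whereas here \<open>d(x, \<emptyset>) = \<infinity>\<close>; hence the
  nonemptiness conditions in this definition and in that of the attraction basin.\<close>

definition eps_ball :: "'a::metric_space set \<Rightarrow> real \<Rightarrow> 'a set"
  where "eps_ball A \<epsilon> = {y. A \<noteq> {} \<and> infdist y A < \<epsilon>}"

definition neighborhood_in :: "'a::metric_space set \<Rightarrow> 'a set \<Rightarrow> 'a set \<Rightarrow> bool"
  where "neighborhood_in Y U A \<longleftrightarrow>
    U \<subseteq> Y \<and> top_of_set Y closure_of A \<subseteq> top_of_set Y interior_of U"

definition attracts :: "(real \<Rightarrow> 'a::metric_space \<Rightarrow> 'a) \<Rightarrow> 'a set \<Rightarrow> 'a set \<Rightarrow> bool"
  where "attracts S A B \<longleftrightarrow> (\<forall>\<epsilon>>0. \<exists>T>0. \<forall>t>T. S t ` B \<subseteq> eps_ball A \<epsilon>)"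

definition invariant :: "(real \<Rightarrow> 'a \<Rightarrow> 'a) \<Rightarrow> 'a set \<Rightarrow> bool"
  where "invariant S A \<longleftrightarrow> (\<forall>t\<ge>0. S t ` A = A)"

definition positively_invariant :: "(real \<Rightarrow> 'a \<Rightarrow> 'a) \<Rightarrow> 'a set \<Rightarrow> bool"
  where "positively_invariant S A \<longleftrightarrow> (\<forall>t\<ge>0. S t ` A \<subseteq> A)"

text \<open>Attractors of the restriction of \<open>S\<close> to a positively invariant set \<open>Y\<close>: neighborhoods are
  taken in the subspace \<open>Y\<close>.  With \<open>Y = UNIV\<close> these are the attractors of \<open>S\<close> in the whole space.\<close>

definition attractor_in :: "(real \<Rightarrow> 'a::metric_space \<Rightarrow> 'a) \<Rightarrow> 'a set \<Rightarrow> 'a set \<Rightarrow> bool"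
  where "attractor_in S Y A \<longleftrightarrow>
    A \<subseteq> Y \<and> compact A \<and> invariant S A \<and> (\<exists>U. neighborhood_in Y U A \<and> attracts S A U)"

abbreviation neighborhood :: "'a::metric_space set \<Rightarrow> 'a set \<Rightarrow> bool"
  where "neighborhood \<equiv> neighborhood_in UNIV"

abbreviation attractor :: "(real \<Rightarrow> 'a::metric_space \<Rightarrow> 'a) \<Rightarrow> 'a set \<Rightarrow> bool"
  where "attractor S \<equiv> attractor_in S UNIV"

lemma neighborhood_iff: "neighborhood U A \<longleftrightarrow> closure A \<subseteq> interior U"
  by (simp add: neighborhood_in_def)

definition attraction_basin :: "(real \<Rightarrow> 'a::metric_space \<Rightarrow> 'a) \<Rightarrow> 'a set \<Rightarrow> 'a set"
  where "attraction_basin S A = {x. A \<noteq> {} \<and> ((\<lambda>t. infdist (S t x) A) \<longlongrightarrow> 0) at_top}"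

definition omega_limit :: "(real \<Rightarrow> 'a::metric_space \<Rightarrow> 'a) \<Rightarrow> 'a \<Rightarrow> 'a set"
  where "omega_limit S x =
    {y. \<exists>t. (\<forall>n::nat. t n \<ge> 0) \<and> filterlim t at_top sequentially \<and> (\<lambda>n. S (t n) x) \<longlonglongrightarrow> y}"

definition dual_repeller :: "(real \<Rightarrow> 'a::metric_space \<Rightarrow> 'a) \<Rightarrow> 'a set \<Rightarrow> 'a set \<Rightarrow> 'a set"
  where "dual_repeller S \<AA> A = {x \<in> \<AA>. omega_limit S x \<inter> A = {}}"

text \<open>\<open>M 1, \<dots>, M l\<close> is a Morse decomposition of \<open>\<AA>\<close> with Morse filtration \<open>A 0, \<dots>, A l\<close>.
  The values of \<open>M\<close> and \<open>A\<close> at other indices are irrelevant.\<close>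

definition morse_decomposition ::
    "(real \<Rightarrow> 'a::metric_space \<Rightarrow> 'a) \<Rightarrow> 'a set \<Rightarrow> nat \<Rightarrow> (nat \<Rightarrow> 'a set) \<Rightarrow> (nat \<Rightarrow> 'a set) \<Rightarrow> bool"
  where "morse_decomposition S \<AA> l A M \<longleftrightarrow>
    A 0 = {} \<and> A l = \<AA> \<and>
    (\<forall>k<l. A k \<subset> A (Suc k)) \<and>
    (\<forall>k\<le>l. attractor_in S \<AA> (A k)) \<and>
    (\<forall>k\<in>{1..l}. M k = A k \<inter> dual_repeller S \<AA> (A (k - 1)))"

definition morse_lyapunov ::
    "(real \<Rightarrow> 'a::metric_space \<Rightarrow> 'a) \<Rightarrow> 'a set \<Rightarrow> nat \<Rightarrow> (nat \<Rightarrow> 'a set) \<Rightarrow> ('a \<Rightarrow> real) \<Rightarrow> bool"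
  where "morse_lyapunov S \<Omega> l M V \<longleftrightarrow>
    continuous_on \<Omega> V \<and>
    (\<forall>k\<in>{1..l}. V constant_on M k) \<and>
    (\<forall>x\<in>\<Omega> - (\<Union>k\<in>{1..l}. M k). strict_antimono_on {0..} (\<lambda>t. V (S t x)))"

text \<open>The constant value \<open>c\<^sub>k = V(M\<^sub>k)\<close>; Morse sets are nonempty because the filtration is
  strictly increasing.\<close>

definition critical_value :: "('a \<Rightarrow> real) \<Rightarrow> (nat \<Rightarrow> 'a set) \<Rightarrow> nat \<Rightarrow> real"
  where "critical_value V M k = the_elem (V ` M k)"

definition strict_morse_lyapunov ::
    "(real \<Rightarrow> 'a::metric_space \<Rightarrow> 'a) \<Rightarrow> 'a set \<Rightarrow> nat \<Rightarrow> (nat \<Rightarrow> 'a set) \<Rightarrow> ('a \<Rightarrow> real) \<Rightarrow> bool"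
  where "strict_morse_lyapunov S \<Omega> l M V \<longleftrightarrow>
    morse_lyapunov S \<Omega> l M V \<and> strict_mono_on {1..l} (critical_value V M)"

definition sublevel :: "'a set \<Rightarrow> ('a \<Rightarrow> real) \<Rightarrow> real \<Rightarrow> 'a set"
  where "sublevel \<Omega> V a = {x \<in> \<Omega>. V x \<le> a}"

definition isolates_critical_value ::
    "('a \<Rightarrow> real) \<Rightarrow> nat \<Rightarrow> (nat \<Rightarrow> 'a set) \<Rightarrow> nat \<Rightarrow> real \<Rightarrow> real \<Rightarrow> bool"
  where "isolates_critical_value V l M k a b \<longleftrightarrow>
    a < critical_value V M k \<and> critical_value V M k < b \<and>
    critical_value V M ` {1..l} \<inter> {a..b} = {critical_value V M k}"

text \<open>A critical group \<open>C\<^sub>q(M\<^sub>k)\<close> is determined only up to isomorphism, through auxiliary choices: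
  it is represented by \<open>H\<^sub>q(V\<^sub>b, V\<^sub>a)\<close> for any strict Morse-Lyapunov function \<open>V\<close> on \<open>\<Omega>\<close> and any
  levels \<open>a\<close>, \<open>b\<close> isolating \<open>c\<^sub>k\<close>.\<close>

definition critical_group ::
    "'g::ab_group_add itself \<Rightarrow> nat \<Rightarrow> 'a::metric_space set \<Rightarrow> ('a \<Rightarrow> real) \<Rightarrow> real \<Rightarrow> real \<Rightarrow>
     ('a, 'g) coeff_chain set monoid"
  where "critical_group G q \<Omega> V a b =
    coeff_homology_group G q (top_of_set (sublevel \<Omega> V b)) (sublevel \<Omega> V a)"

end

theory Submission
  imports Defs
begin

text \<open>
  Write \<open>V\<^sub>r\<close> for the sublevel sets of the Lyapunov function.  By LaSalle's principle every trajectory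
  in \<open>V\<^sub>b\<close> tends to \<open>A k\<close> and every trajectory in \<open>V\<^sub>a\<close> tends to \<open>A (k - 1)\<close>, so that \<open>V\<^sub>b\<close> and \<open>V\<^sub>a\<close>
  are themselves positively invariant neighborhoods inside these basins.  Put \<open>P = W\<^sub>k \<inter> V\<^sub>b\<close> and
  \<open>Q = P \<inter> W\<^sub>k\<^sub>-\<^sub>1 \<inter> V\<^sub>a\<close>.  The flow carries each compact subset of \<open>W\<^sub>k\<close> or \<open>V\<^sub>b\<close> into \<open>P\<close> in finite time,
  and each compact subset of \<open>W\<^sub>k \<inter> W\<^sub>k\<^sub>-\<^sub>1\<close> or \<open>V\<^sub>a\<close> into \<open>Q\<close>.  Since singular chains have compact support,
  the prism chain homotopy along the flow shows that the inclusions of \<open>(P, Q)\<close> into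
  \<open>(W\<^sub>k, W\<^sub>k\<^sub>-\<^sub>1)\<close> and into \<open>(V\<^sub>b, V\<^sub>a)\<close> induce isomorphisms.
\<close>

section \<open>Chains with coefficients\<close>

text \<open>The integral multiple in an abelian group. At least one of the two sums is empty, so
  negative \<open>n\<close> needs no separate clause.\<close>

definition int_scale :: "int \<Rightarrow> 'g::ab_group_add \<Rightarrow> 'g"
  where "int_scale n g = (\<Sum>i<nat n. g) - (\<Sum>i<nat (- n). g)"

lemma sum_const_lessThan_add:
  fixes g :: "'g::ab_group_add"
  shows "(\<Sum>i<m + n. g) = (\<Sum>i<m::nat. g) + (\<Sum>i<n::nat. g)"
  by (induction n) (simp_all add: algebra_simps)

text \<open>The value does not depend on how the integer is written as a difference of naturals, so
  additivity in the integer follows without sign cases.\<close>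

lemma int_scale_of_diff: "int_scale (int a - int b) g = (\<Sum>i<a. g) - (\<Sum>i<b. g)"
proof (cases "a \<le> b")
  case True
  then obtain d where "b = a + d" using le_Suc_ex by blast
  then show ?thesis by (simp add: int_scale_def sum_const_lessThan_add)
next
  case False
  then obtain d where "a = b + d" by (metis le_Suc_ex nat_le_linear)
  then show ?thesis by (simp add: int_scale_def sum_const_lessThan_add)
qed

lemma int_scale_simps [simp]:
  "int_scale 0 g = 0" "int_scale 1 g = g" "int_scale n 0 = 0"
  by (simp_all add: int_scale_def)

lemma int_scale_diff: "int_scale (m - n) g = int_scale m g - int_scale n g"
proof -
  obtain a b c d where "m = int a - int b" "n = int c - int d"
    by (meson int_diff_cases)
  moreover have "int a - int b - (int c - int d) = int (a + d) - int (b + c)"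
    by simp
  ultimately have "int_scale (m - n) g = (\<Sum>i<a + d. g) - (\<Sum>i<b + c. g)"
    using int_scale_of_diff by metis
  then show ?thesis
    by (simp add: sum_const_lessThan_add int_scale_of_diff \<open>m = _\<close> \<open>n = _\<close> algebra_simps)
qed

lemma int_scale_minus: "int_scale (- n) g = - int_scale n g"
  using int_scale_diff [of 0 n g] by simp

lemma int_scale_add_right: "int_scale n (g + h) = int_scale n g + int_scale n h"
  by (simp add: int_scale_def sum.distrib)

text \<open>The elementary tensor of \<open>g\<close> and \<open>z\<close>, when a free abelian
  group tensored with the coefficients is identified with finitely supported functions.\<close>

definition frag_tensor :: "'g::ab_group_add \<Rightarrow> ('a \<Rightarrow>\<^sub>0 int) \<Rightarrow> ('a \<Rightarrow>\<^sub>0 'g)"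
  where "frag_tensor g z = Poly_Mapping.map (\<lambda>n. int_scale n g) z"

lemma lookup_frag_tensor [simp]: "Poly_Mapping.lookup (frag_tensor g z) x = int_scale (Poly_Mapping.lookup z x) g"
  by (simp add: frag_tensor_def map.rep_eq when_def)

lemma frag_tensor_of [simp]: "frag_tensor g (frag_of x) = Poly_Mapping.single x g"
  by (rule poly_mapping_eqI) (simp add: lookup_single when_def)

lemma frag_tensor_0 [simp]: "frag_tensor g 0 = 0" "frag_tensor 0 z = 0"
  by (rule poly_mapping_eqI, simp)+

lemma frag_tensor_add_left: "frag_tensor (g + h) z = frag_tensor g z + frag_tensor h z"
  by (rule poly_mapping_eqI) (simp add: lookup_add int_scale_add_right)

lemma frag_tensor_diff: "frag_tensor g (y - z) = frag_tensor g y - frag_tensor g z"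
  by (rule poly_mapping_eqI) (simp add: lookup_minus int_scale_diff)

lemma frag_tensor_minus: "frag_tensor g (- z) = - frag_tensor g z"
  by (rule poly_mapping_eqI) (simp add: int_scale_minus)

lemma frag_tensor_sum: "frag_tensor g (\<Sum>i\<in>I. z i) = (\<Sum>i\<in>I. frag_tensor g (z i))"
proof (induction I rule: infinite_finite_induct)
  case (insert i I)
  have "frag_tensor g (z i + sum z I) = frag_tensor g (z i) + frag_tensor g (sum z I)"
    using frag_tensor_diff [of g "z i" "- sum z I"] by (simp add: frag_tensor_minus)
  with insert show ?case by simp
qed auto

text \<open>The homomorphism given on generators by \<open>b\<close>, tensored with the identity of
  the coefficients. The boundary, chain maps and prisms all have this form, so their identities
  reduce to integral chains on single simplices.\<close>

definition coeff_extend :: "('b \<Rightarrow> 'a \<Rightarrow>\<^sub>0 int) \<Rightarrow> ('b \<Rightarrow>\<^sub>0 'g::ab_group_add) \<Rightarrow> ('a \<Rightarrow>\<^sub>0 'g)"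
  where "coeff_extend b c = (\<Sum>x\<in>Poly_Mapping.keys c. frag_tensor (Poly_Mapping.lookup c x) (b x))"

lemma coeff_extend_superset:
  assumes "finite A" "Poly_Mapping.keys c \<subseteq> A"
  shows "coeff_extend b c = (\<Sum>x\<in>A. frag_tensor (Poly_Mapping.lookup c x) (b x))"
  unfolding coeff_extend_def
  using assms by (intro sum.mono_neutral_left) (auto simp: in_keys_iff)

lemma coeff_extend_0 [simp]: "coeff_extend b 0 = 0"
  by (simp add: coeff_extend_def)

lemma coeff_extend_single [simp]: "coeff_extend b (Poly_Mapping.single x g) = frag_tensor g (b x)"
  by (simp add: coeff_extend_def)

lemma coeff_extend_add: "coeff_extend b (c + d) = coeff_extend b c + coeff_extend b d"
proof -
  have "Poly_Mapping.keys (c + d) \<subseteq> Poly_Mapping.keys c \<union> Poly_Mapping.keys d"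
    by (rule keys_add)
  then show ?thesis
    by (simp add: coeff_extend_superset [of "Poly_Mapping.keys c \<union> Poly_Mapping.keys d"] lookup_add frag_tensor_add_left
        sum.distrib)
qed

lemma coeff_extend_minus: "coeff_extend b (- c) = - coeff_extend b c"
  using coeff_extend_add [of b c "- c"] by (simp add: eq_neg_iff_add_eq_0 add.commute)

lemma coeff_extend_diff: "coeff_extend b (c - d) = coeff_extend b c - coeff_extend b d"
  using coeff_extend_add [of b c "- d"] by (simp add: coeff_extend_minus)

lemma coeff_extend_sum: "coeff_extend b (\<Sum>i\<in>I. c i) = (\<Sum>i\<in>I. coeff_extend b (c i))"
  by (induction I rule: infinite_finite_induct) (simp_all add: coeff_extend_add)

lemma coeff_extend_cong:
  assumes "\<And>x. x \<in> Poly_Mapping.keys c \<Longrightarrow> b x = b' x"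
  shows "coeff_extend b c = coeff_extend b' c"
  using assms by (simp add: coeff_extend_def)

lemma coeff_extend_diff_fun:
  "coeff_extend (\<lambda>x. b x - b' x) c = coeff_extend b c - coeff_extend b' c"
  by (simp add: coeff_extend_def frag_tensor_diff sum_subtractf)

lemma coeff_extend_tensor: "coeff_extend b (frag_tensor g z) = frag_tensor g (frag_extend b z)"
  using subset_UNIV
  by (induction z rule: frag_induction)
     (simp_all add: frag_tensor_diff coeff_extend_diff frag_extend_diff)

text \<open>Tensoring respects composition. This transports identities between integral operators,
  such as the vanishing of the double boundary.\<close>

lemma coeff_extend_compose:
  "coeff_extend b (coeff_extend b' c) = coeff_extend (\<lambda>x. frag_extend b (b' x)) c"
  unfolding coeff_extend_def [of b'] coeff_extend_sum coeff_extend_tensor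
  by (simp add: coeff_extend_def)

lemma coeff_extend_of: "coeff_extend frag_of c = c"
proof (rule poly_mapping_eqI)
  fix y
  show "Poly_Mapping.lookup (coeff_extend frag_of c) y = Poly_Mapping.lookup c y"
    by (auto simp: coeff_extend_def lookup_sum lookup_single when_def in_keys_iff
        if_distrib [of "\<lambda>n. int_scale n _"] cong: if_cong)
qed

lemma keys_coeff_extend: "Poly_Mapping.keys (coeff_extend b c) \<subseteq> (\<Union>x\<in>Poly_Mapping.keys c. Poly_Mapping.keys (b x))"
proof
  fix y
  assume "y \<in> Poly_Mapping.keys (coeff_extend b c)"
  then have "(\<Sum>x\<in>Poly_Mapping.keys c. Poly_Mapping.lookup (frag_tensor (Poly_Mapping.lookup c x) (b x)) y) \<noteq> 0"
    by (simp add: coeff_extend_def in_keys_iff lookup_sum)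
  then obtain x where "x \<in> Poly_Mapping.keys c"
      "Poly_Mapping.lookup (frag_tensor (Poly_Mapping.lookup c x) (b x)) y \<noteq> 0"
    using sum.not_neutral_contains_not_neutral by blast
  then show "y \<in> (\<Union>x\<in>Poly_Mapping.keys c. Poly_Mapping.keys (b x))"
    by (metis UN_I in_keys_iff int_scale_simps(1) lookup_frag_tensor)
qed

section \<open>Singular chains, boundaries and chain maps with coefficients\<close>

lemma coeff_singular_chain_extend:
  assumes "\<And>f. f \<in> Poly_Mapping.keys c \<Longrightarrow> singular_chain p X (b f)"
  shows "coeff_singular_chain p X (coeff_extend b c)"
  using keys_coeff_extend [of b c] assms
  unfolding coeff_singular_chain_def singular_chain_def by blast

lemma coeff_singular_chain_0 [simp]: "coeff_singular_chain p X 0"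
  by (simp add: coeff_singular_chain_def)

lemma coeff_singular_chain_minus [simp]:
  "coeff_singular_chain p X (- c) \<longleftrightarrow> coeff_singular_chain p X c"
  by (simp add: coeff_singular_chain_def)

lemma coeff_singular_chain_add:
  "coeff_singular_chain p X c \<Longrightarrow> coeff_singular_chain p X d \<Longrightarrow> coeff_singular_chain p X (c + d)"
  unfolding coeff_singular_chain_def using keys_add [of c d] by blast

lemma coeff_singular_chain_diff:
  "coeff_singular_chain p X c \<Longrightarrow> coeff_singular_chain p X d \<Longrightarrow> coeff_singular_chain p X (c - d)"
  using coeff_singular_chain_add [of p X c "- d"] by simp

text \<open>Identifies the explicit alternating sum with the integral boundary tensored with the
  coefficients, so that the integral theory applies one simplex at a time.\<close>

lemma coeff_boundary_extend:
  "coeff_boundary p c = coeff_extend (\<lambda>f. chain_boundary p (frag_of f)) c"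
proof (cases "p = 0")
  case True
  then show ?thesis
    by (simp add: coeff_boundary_def coeff_extend_def chain_boundary_def)
next
  case False
  have "frag_tensor g (frag_cmul ((-1) ^ k) (frag_of x)) = Poly_Mapping.single x (if even k then g else - g)"
    for g :: 'b and k and x :: "(nat \<Rightarrow> real) \<Rightarrow> 'a"
    by (auto simp: frag_tensor_minus single_uminus)
  with False show ?thesis
    by (simp add: coeff_boundary_def coeff_extend_def chain_boundary_of frag_tensor_sum)
qed

lemma frag_extend_chain_boundary:
  "frag_extend (\<lambda>f. chain_boundary p (frag_of f)) z = chain_boundary p z"
  using subset_UNIV
  by (induction z rule: frag_induction) (simp_all add: frag_extend_diff chain_boundary_diff)

lemma coeff_boundary_of_extend:
  "coeff_boundary p (coeff_extend b c) = coeff_extend (\<lambda>f. chain_boundary p (b f)) c"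
  by (simp add: coeff_boundary_extend coeff_extend_compose frag_extend_chain_boundary)

lemma coeff_boundary_0 [simp]: "coeff_boundary p 0 = 0"
  by (simp add: coeff_boundary_extend)

lemma coeff_boundary_add: "coeff_boundary p (c + d) = coeff_boundary p c + coeff_boundary p d"
  by (simp add: coeff_boundary_extend coeff_extend_add)

lemma coeff_boundary_minus: "coeff_boundary p (- c) = - coeff_boundary p c"
  by (simp add: coeff_boundary_extend coeff_extend_minus)

lemma coeff_boundary_diff: "coeff_boundary p (c - d) = coeff_boundary p c - coeff_boundary p d"
  by (simp add: coeff_boundary_extend coeff_extend_diff)

lemma coeff_singular_chain_boundary:
  assumes "coeff_singular_chain p X c"
  shows "coeff_singular_chain (p - 1) X (coeff_boundary p c)"
proof -
  have "singular_chain (p - Suc 0) X (chain_boundary p (frag_of f))" if "f \<in> Poly_Mapping.keys c" for f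
    using assms that
    by (intro singular_chain_boundary) (auto simp: singular_chain_of coeff_singular_chain_def)
  then show ?thesis
    unfolding coeff_boundary_extend by (intro coeff_singular_chain_extend) simp
qed

lemma coeff_boundary_boundary:
  assumes "coeff_singular_chain p X c"
  shows "coeff_boundary (p - 1) (coeff_boundary p c) = 0"
proof -
  have "chain_boundary (p - 1) (chain_boundary p (frag_of f)) = 0" if "f \<in> Poly_Mapping.keys c" for f
    using assms that chain_boundary_boundary [of p X "frag_of f"]
    by (auto simp: singular_chain_of coeff_singular_chain_def)
  then have "coeff_boundary (p - 1) (coeff_boundary p c) = coeff_extend (\<lambda>f. 0) c"
    unfolding coeff_boundary_extend [of p] coeff_boundary_of_extend
    by (intro coeff_extend_cong) auto
  then show ?thesis
    by (simp add: coeff_extend_def)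
qed

lemma coeff_singular_chain_subtopology:
  "coeff_singular_chain p (subtopology X T) c \<longleftrightarrow>
     coeff_singular_chain p X c \<and> (\<forall>f\<in>Poly_Mapping.keys c. f ` standard_simplex p \<subseteq> T)"
  by (simp add: coeff_singular_chain_def singular_simplex_subtopology subset_iff) blast

definition coeff_chain_map ::
    "nat \<Rightarrow> ('b \<Rightarrow> 'a) \<Rightarrow> ('b, 'g::ab_group_add) coeff_chain \<Rightarrow> ('a, 'g) coeff_chain"
  where "coeff_chain_map p g c = coeff_extend (\<lambda>f. frag_of (simplex_map p g f)) c"

lemma coeff_chain_map_diff:
  "coeff_chain_map p g (c - d) = coeff_chain_map p g c - coeff_chain_map p g d"
  by (simp add: coeff_chain_map_def coeff_extend_diff)

text \<open>The hypothesis concerns only simplices that occur in \<open>c\<close>: a map may push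
  this particular chain into a smaller space without sending all of \<open>X\<close> there.\<close>

lemma coeff_singular_chain_map:
  assumes "coeff_singular_chain p X c"
    and "\<And>f. f \<in> Poly_Mapping.keys c \<Longrightarrow> singular_simplex p Y (simplex_map p g f)"
  shows "coeff_singular_chain p Y (coeff_chain_map p g c)"
  unfolding coeff_chain_map_def using assms
  by (intro coeff_singular_chain_extend) (simp add: singular_chain_of)

lemma coeff_chain_map_ident:
  assumes "coeff_singular_chain p X c" "\<And>x. x \<in> topspace X \<Longrightarrow> g x = x"
  shows "coeff_chain_map p g c = c"
proof -
  have "coeff_chain_map p g c = coeff_extend frag_of c"
    unfolding coeff_chain_map_def using assms
    by (intro coeff_extend_cong) (auto simp: coeff_singular_chain_def simplex_map_id_gen)
  then show ?thesis by (simp add: coeff_extend_of)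
qed

lemma coeff_boundary_chain_map:
  assumes "coeff_singular_chain p X c"
  shows "coeff_boundary p (coeff_chain_map p g c) = coeff_chain_map (p - 1) g (coeff_boundary p c)"
proof -
  have "chain_boundary p (frag_of (simplex_map p g f))
        = frag_extend (\<lambda>f. frag_of (simplex_map (p - 1) g f)) (chain_boundary p (frag_of f))"
    if "f \<in> Poly_Mapping.keys c" for f
    using that assms chain_boundary_chain_map [of p X "frag_of f" g]
    by (auto simp: chain_map_def o_def coeff_singular_chain_def singular_chain_of)
  then show ?thesis
    unfolding coeff_chain_map_def coeff_boundary_of_extend coeff_boundary_extend [of _ c] coeff_extend_compose
    by (rule coeff_extend_cong)
qed

section \<open>The prism operator\<close>

abbreviation std_simplex_space :: "nat \<Rightarrow> (nat \<Rightarrow> real) topology"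
  where "std_simplex_space q \<equiv> subtopology (powertop_real UNIV) (standard_simplex q)"

definition prism_space :: "nat \<Rightarrow> (real \<times> (nat \<Rightarrow> real)) topology"
  where "prism_space q = prod_topology (top_of_set {0..1}) (std_simplex_space q)"

lemma topspace_prism_space [simp]: "topspace (prism_space q) = {0..1} \<times> standard_simplex q"
  by (simp add: prism_space_def)

section \<open>Contractible models\<close>

lemma contractible_space_standard_simplex: "contractible_space (std_simplex_space q)"
proof -
  \<comment> \<open>A vertex of the simplex; the straight-line homotopy towards it stays inside by
    convexity.\<close>
  define e :: "nat \<Rightarrow> real" where "e = (\<lambda>j. if j = 0 then 1 else 0)"
  define h where "h = (\<lambda>(u::real, x::nat \<Rightarrow> real) i. (1 - u) * x i + u * e i)"
  have e: "e \<in> standard_simplex q"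
    unfolding e_def by simp
  have "continuous_map (prod_topology (top_of_set {0..1}) (std_simplex_space q)) (powertop_real UNIV) h"
    unfolding continuous_map_componentwise_UNIV
  proof
    fix k
    let ?P = "prod_topology (top_of_set {0..1::real}) (std_simplex_space q)"
    have 1: "continuous_map ?P euclideanreal fst"
      by (rule continuous_map_into_fulltopology [OF continuous_map_fst])
    have 2: "continuous_map ?P euclideanreal (\<lambda>z. snd z k)"
      using continuous_map_compose [OF continuous_map_snd
          continuous_map_from_subtopology [OF continuous_map_product_projection [of k UNIV]]]
      by (simp add: o_def)
    have "continuous_map ?P euclideanreal (\<lambda>z. (1 - fst z) * snd z k + fst z * e k)"
      by (intro continuous_map_add continuous_map_diff continuous_map_real_mult 1 2) simp_all
    then show "continuous_map ?P euclideanreal (\<lambda>x. h x k)"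
      by (simp add: h_def case_prod_unfold)
  qed
  moreover have "h ` topspace (prod_topology (top_of_set {0..1}) (std_simplex_space q)) \<subseteq> standard_simplex q"
    using convex_standard_simplex [OF _ e] by (auto simp: h_def)
  ultimately have "homotopic_with (\<lambda>x. True) (std_simplex_space q) (std_simplex_space q) id (\<lambda>x. e)"
    unfolding homotopic_with_def
    by (intro exI [of _ h]) (auto simp: continuous_map_in_subtopology h_def)
  then show ?thesis
    by (auto simp: contractible_space_def)
qed

lemma contractible_space_prism_space: "contractible_space (prism_space q)"
  unfolding prism_space_def contractible_space_prod_topology
  by (simp add: contractible_space_standard_simplex convex_imp_contractible)

text \<open>For \<open>q = 0\<close> the hypothesis \<open>const\<close> demands that the augmentation of \<open>z\<close> vanishes.\<close>

lemma contractible_space_cycle_imp_boundary: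
  fixes X :: "'a topology"
  assumes X: "contractible_space X" and z: "singular_chain q X z" "chain_boundary q z = 0"
    and const: "\<And>a::'a. q = 0 \<Longrightarrow> chain_map q (\<lambda>x. a) z = 0"
  obtains d where "singular_chain (Suc q) X d" "chain_boundary (Suc q) d = z"
proof (cases "topspace X = {}")
  case True
  then have "z = 0"
    using z singular_chain_empty by blast
  with that [of 0] show ?thesis by simp
next
  case False
  obtain a where hom: "homotopic_with (\<lambda>x. True) X X id (\<lambda>x. a)"
    using X by (auto simp: contractible_space_def)
  then have cont: "continuous_map X X (\<lambda>x. a)"
    using homotopic_with_imp_continuous_maps by blast
  then have a: "a \<in> topspace X"
    using False by (auto simp: continuous_map_def)
  have z': "singular_relcycle q X {} z"
    using z by (simp add: singular_cycle)
  \<comment> \<open>The contraction makes \<open>z\<close> homologous to its image under a constant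
    map.\<close>
  have "homologous_rel q X {} (chain_map q id z) (chain_map q (\<lambda>x. a) z)"
    by (rule homotopic_imp_homologous_rel_chain_maps [OF homotopic_with_mono [OF hom] z']) auto
  then have 1: "singular_relboundary q X {} (z - chain_map q (\<lambda>x. a) z)"
    using chain_map_ident [OF z(1)] by (simp add: homologous_rel_def)
  \<comment> \<open>In positive dimension a point has no homology, so the collapsed cycle bounds; in
    dimension 0 it vanishes by \<open>const\<close>.\<close>
  have 2: "singular_relboundary q X {} (chain_map q (\<lambda>x. a) z)"
  proof (cases "q = 0")
    case True
    then show ?thesis
      using const [OF True] by simp
  next
    case False
    have "continuous_map X (subtopology X {a}) (\<lambda>x. a)"
      using a by (simp add: continuous_map_in_subtopology)
    then have "singular_relcycle q (subtopology X {a}) {} (chain_map q (\<lambda>x. a) z)"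
      by (intro singular_relcycle_chain_map [OF z']) auto
    then have "singular_relboundary q (subtopology X {a}) {} (chain_map q (\<lambda>x. a) z)"
      using False a by (subst singular_boundary_eq_cycle_singleton [of _ a]) auto
    then show ?thesis
      using singular_boundary_mono [of "{a}" "topspace X" q X] a by simp
  qed
  show ?thesis
    using singular_relboundary_add [OF 1 2] that by (auto simp: singular_boundary)
qed

text \<open>Pushing a fixed chain \<open>d\<close> of the model cylinder along \<open>f\<close> and
  \<open>h\<close> builds naturality in \<open>f\<close> into the definition. The index is the
  dimension of \<open>d\<close>, one more than that of \<open>f\<close> in the homotopy
  formulas.\<close>

definition prism_op ::
    "nat \<Rightarrow> (real \<times> (nat \<Rightarrow> real)) chain \<Rightarrow> (real \<times> 'b \<Rightarrow> 'a) \<Rightarrow> ((nat \<Rightarrow> real) \<Rightarrow> 'b) \<Rightarrow> 'a chain"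
  where "prism_op q d h f = chain_map q (\<lambda>(t, z). h (t, f z)) d"

text \<open>The identity simplex; singular simplices are extensional functions, hence the
  restriction.\<close>

abbreviation model_simplex :: "nat \<Rightarrow> (nat \<Rightarrow> real) \<Rightarrow> nat \<Rightarrow> real"
  where "model_simplex q \<equiv> restrict id (standard_simplex q)"

lemma singular_simplex_model: "singular_simplex q (std_simplex_space q) (model_simplex q)"
  unfolding singular_simplex_def
  by (auto intro: continuous_map_eq [OF continuous_map_id])

text \<open>Acyclic models: the prism over the simplex of dimension \<open>q\<close> is any chain of the contractible
  space \<open>prism_space q\<close> that fills the shell made of the two ends and of the prisms, given by \<open>d\<close>, over the faces.\<close>

definition prism_shell ::
    "nat \<Rightarrow> (real \<times> (nat \<Rightarrow> real)) chain \<Rightarrow> (real \<times> (nat \<Rightarrow> real)) chain"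
  where "prism_shell q d =
    frag_of (simplex_map q (Pair 1) (model_simplex q)) - frag_of (simplex_map q (Pair 0) (model_simplex q))
    - frag_extend (prism_op q d id) (chain_boundary q (frag_of (model_simplex q)))"

text \<open>Naturality of prisms. Only values over the cylinder are compared, because simplices
  carry meaningful values on the standard simplex alone.\<close>

lemma chain_map_prism_op:
  assumes "singular_chain q (prism_space p) d"
    and "\<And>t z. \<lbrakk>t \<in> {0..1}; z \<in> standard_simplex p\<rbrakk> \<Longrightarrow> g (k (t, f z)) = h (t, f' z)"
  shows "chain_map q g (prism_op q d k f) = prism_op q d h f'"
proof -
  have "chain_map q g (prism_op q d k f) = chain_map q (g \<circ> (\<lambda>(t, z). k (t, f z))) d"
    by (simp add: prism_op_def chain_map_compose)
  also have "\<dots> = prism_op q d h f'"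
    unfolding prism_op_def by (rule chain_map_eq [OF assms(1)]) (use assms(2) in auto)
  finally show ?thesis .
qed

text \<open>The prism formula over an arbitrary \<open>f\<close> is the image of the shell equation
  over the model simplex, under the map of cylinders induced by \<open>f\<close> and
  \<open>h\<close>.\<close>

lemma chain_boundary_prism_op:
  assumes d: "singular_chain (Suc q) (prism_space q) d" "chain_boundary (Suc q) d = prism_shell q d'"
    and d': "0 < q \<Longrightarrow> singular_chain q (prism_space (q - 1)) d'"
  shows "chain_boundary (Suc q) (prism_op (Suc q) d h f) =
      frag_of (simplex_map q (\<lambda>x. h (1, x)) f) - frag_of (simplex_map q (\<lambda>x. h (0, x)) f)
      - frag_extend (prism_op q d' h) (chain_boundary q (frag_of f))"
proof -
  let ?F = "\<lambda>(t, z). h (t, f z)"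
  have ends: "simplex_map q ?F (simplex_map q (Pair s) (model_simplex q)) = simplex_map q (\<lambda>x. h (s, x)) f" for s
    by (auto simp: simplex_map_def)
  have "chain_map q ?F (frag_extend (prism_op q d' id) (chain_boundary q (frag_of (model_simplex q))))
      = frag_extend (prism_op q d' h) (chain_boundary q (frag_of f))"
  proof (cases "q = 0")
    case False
    \<comment> \<open>A face of the model simplex is the inclusion of that face, so following it by
      \<open>f\<close> gives the corresponding face of \<open>f\<close>.\<close>
    have "chain_map q ?F (prism_op q d' id (singular_face q k (model_simplex q)))
        = prism_op q d' h (singular_face q k f)" if "k \<le> q" for k
      using False that
      by (intro chain_map_prism_op [OF d'])
         (auto simp: singular_face_def simplical_face_in_standard_simplex)
    then show ?thesis
      using False
      by (simp add: chain_boundary_of frag_extend_sum chain_map_sum o_def frag_extend_cmul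
          del: singular_face_restrict)
  qed (simp add: chain_boundary_def)
  then show ?thesis
    unfolding prism_op_def [of "Suc q"]
    by (simp add: chain_boundary_chain_map [OF d(1)] d(2) prism_shell_def chain_map_diff ends)
qed

lemma chain_boundary_frag_extend:
  "chain_boundary p (frag_extend b z) = frag_extend (\<lambda>f. chain_boundary p (b f)) z"
  using subset_UNIV
  by (induction z rule: frag_induction) (simp_all add: frag_extend_diff chain_boundary_diff)

lemma frag_extend_diff_fun:
  "frag_extend (\<lambda>f. b f - b' f) z = frag_extend b z - frag_extend b' z"
  using subset_UNIV
  by (induction z rule: frag_induction) (simp_all add: frag_extend_diff)

lemma frag_extend_frag_extend:
  "frag_extend (\<lambda>f. frag_extend b (b' f)) z = frag_extend b (frag_extend b' z)"
  using subset_UNIV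
  by (induction z rule: frag_induction) (simp_all add: frag_extend_diff)

lemma singular_chain_prism_op:
  assumes d: "singular_chain p (prism_space q) d" and f: "singular_simplex q X f"
    and h: "continuous_map (prod_topology (top_of_set {0..1}) X) Y h"
  shows "singular_chain p Y (prism_op p d h f)"
proof -
  have f': "continuous_map (std_simplex_space q) X f"
    using f by (simp add: singular_simplex_def)
  have "continuous_map (prism_space q) (prod_topology (top_of_set {0..1}) X) (\<lambda>z. (fst z, f (snd z)))"
    unfolding prism_space_def continuous_map_pairwise
    using continuous_map_compose [OF continuous_map_snd f']
    by (simp add: o_def continuous_map_fst)
  from continuous_map_compose [OF this h]
  show ?thesis
    unfolding prism_op_def by (intro singular_chain_chain_map [OF d]) (simp add: o_def case_prod_unfold)
qed

lemma singular_chain_prism_shell: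
  assumes d: "0 < q \<Longrightarrow> singular_chain q (prism_space (q - 1)) d"
  shows "singular_chain q (prism_space q) (prism_shell q d)"
proof -
  have ends: "singular_simplex q (prism_space q) (simplex_map q (Pair s) (model_simplex q))"
    if "s \<in> {0..1}" for s
    using that unfolding prism_space_def
    by (intro singular_simplex_simplex_map [OF singular_simplex_model])
       (simp add: continuous_map_pairwise o_def)
  have "singular_chain q (prism_space q)
     (frag_extend (prism_op q d id) (chain_boundary q (frag_of (model_simplex q))))"
  proof (cases "q = 0")
    case False
    have "singular_chain (q - 1) (std_simplex_space q) (chain_boundary q (frag_of (model_simplex q)))"
      using singular_chain_boundary [of q _ "frag_of (model_simplex q)"] singular_simplex_model
      by (simp add: singular_chain_of)
    moreover have "singular_chain q (prism_space q) (prism_op q d id f)"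
      if "singular_simplex (q - 1) (std_simplex_space q) f" for f
      using singular_chain_prism_op [OF d that, of _ id] False by (simp add: prism_space_def)
    ultimately show ?thesis
      by (intro singular_chain_extend) (auto simp: singular_chain_def)
  qed (simp add: chain_boundary_def)
  with ends [of 0] ends [of 1] show ?thesis
    unfolding prism_shell_def
    by (intro singular_chain_diff) (simp_all add: singular_chain_of)
qed

text \<open>Summing the prism formula over the faces, the term with the double boundary vanishes and
  the rest cancels the boundaries of the two ends. Hence the next shell is a cycle and can be
  filled.\<close>

lemma chain_boundary_prism_shell:
  assumes d: "singular_chain (Suc q) (prism_space q) d" "chain_boundary (Suc q) d = prism_shell q d'"
    and d': "0 < q \<Longrightarrow> singular_chain q (prism_space (q - 1)) d'"
  shows "chain_boundary (Suc q) (prism_shell (Suc q) d) = 0"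
proof -
  define b where "b = chain_boundary (Suc q) (frag_of (model_simplex (Suc q)))"
  have simp: "singular_chain (Suc q) (std_simplex_space (Suc q)) (frag_of (model_simplex (Suc q)))"
    by (simp add: singular_chain_of singular_simplex_model)
  have ends: "chain_boundary (Suc q) (frag_of (simplex_map (Suc q) (Pair s) (model_simplex (Suc q))))
      = chain_map q (Pair s) b" for s
    using chain_boundary_chain_map [OF simp, of "Pair s"] by (simp add: b_def)
  have "chain_boundary q b = 0"
    using chain_boundary_boundary_alt [OF simp] by (simp add: b_def)
  moreover have "frag_extend (\<lambda>f. chain_boundary q (frag_of f)) b = chain_boundary q b"
    by (simp add: frag_extend_chain_boundary)
  ultimately have "frag_extend (prism_op q d' id) (frag_extend (\<lambda>f. chain_boundary q (frag_of f)) b) = 0"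
    by simp
  moreover have "chain_boundary (Suc q) (prism_op (Suc q) d id f) =
      frag_of (simplex_map q (Pair 1) f) - frag_of (simplex_map q (Pair 0) f)
      - frag_extend (prism_op q d' id) (chain_boundary q (frag_of f))"
    for f :: "(nat \<Rightarrow> real) \<Rightarrow> nat \<Rightarrow> real"
    using chain_boundary_prism_op [OF d, where h = id] d' by simp
  ultimately have "chain_boundary (Suc q) (frag_extend (prism_op (Suc q) d id) b)
      = chain_map q (Pair 1) b - chain_map q (Pair 0) b"
    unfolding chain_boundary_frag_extend
    by (simp add: frag_extend_diff_fun frag_extend_frag_extend chain_map_def o_def)
  then show ?thesis
    by (simp add: prism_shell_def chain_boundary_diff ends flip: b_def)
qed

text \<open>Induction on the dimension: each shell is a cycle in a contractible cylinder and
  therefore bounds.\<close>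

lemma prism_chains_exist:
  obtains D :: "nat \<Rightarrow> (real \<times> (nat \<Rightarrow> real)) chain"
  where "\<And>q. singular_chain (Suc q) (prism_space q) (D q)"
    and "\<And>q. chain_boundary (Suc q) (D q) = prism_shell q (D (q - 1))"
proof -
  \<comment> \<open>\<open>P\<close> also records that the next shell is a cycle, which the
    recursion needs to continue. It holds the equation for dimension 0 because \<open>Q\<close> only
    relates consecutive chains.\<close>
  define P where "P = (\<lambda>q d. singular_chain (Suc q) (prism_space q) d
    \<and> chain_boundary (Suc q) (prism_shell (Suc q) d) = 0 \<and> (q = 0 \<longrightarrow> chain_boundary (Suc q) d = prism_shell q 0))"
  define Q where "Q = (\<lambda>q d d'. chain_boundary (Suc (Suc q)) d' = prism_shell (Suc q) d)"
  \<comment> \<open>A 0-simplex has no faces. Hence \<open>D (q - 1)\<close>, which is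
    \<open>D 0\<close> itself at \<open>q = 0\<close>, causes no circularity.\<close>
  have shell0: "prism_shell 0 d = prism_shell 0 0" for d
    by (simp add: prism_shell_def chain_boundary_def)
  have "\<exists>d. P 0 d"
  proof -
    obtain d where d: "singular_chain (Suc 0) (prism_space 0) d" "chain_boundary (Suc 0) d = prism_shell 0 0"
    proof (rule contractible_space_cycle_imp_boundary [OF contractible_space_prism_space])
      show "singular_chain 0 (prism_space 0) (prism_shell 0 0)"
        by (rule singular_chain_prism_shell) simp
      show "chain_boundary 0 (prism_shell 0 0) = 0"
        by (simp add: chain_boundary_def)
      \<comment> \<open>Both ends collapse to the same constant simplex and cancel.\<close>
      show "chain_map 0 (\<lambda>x. a) (prism_shell 0 0) = 0" for a :: "real \<times> (nat \<Rightarrow> real)"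
        by (simp add: prism_shell_def chain_map_diff chain_boundary_def) (simp add: simplex_map_def o_def)
    qed
    then show ?thesis
      using chain_boundary_prism_shell [OF d] by (auto simp: P_def)
  qed
  moreover have "\<exists>d'. P (Suc q) d' \<and> Q q d d'" if "P q d" for q d
  proof -
    have d: "singular_chain (Suc q) (prism_space q) d" "chain_boundary (Suc q) (prism_shell (Suc q) d) = 0"
      using that by (auto simp: P_def)
    have "singular_chain (Suc q) (prism_space (Suc q)) (prism_shell (Suc q) d)"
      using d by (intro singular_chain_prism_shell) simp
    then obtain d' where d': "singular_chain (Suc (Suc q)) (prism_space (Suc q)) d'"
        "chain_boundary (Suc (Suc q)) d' = prism_shell (Suc q) d"
      using d(2) by (rule contractible_space_cycle_imp_boundary [OF contractible_space_prism_space]) auto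
    then show ?thesis
      using chain_boundary_prism_shell [OF d'] d by (auto simp: P_def Q_def)
  qed
  ultimately obtain D where D: "\<And>q. P q (D q)" "\<And>q. Q q (D q) (D (Suc q))"
    using dependent_nat_choice [of P Q] by blast
  show ?thesis
  proof
    show "singular_chain (Suc q) (prism_space q) (D q)" for q
      using D(1) by (simp add: P_def)
    show "chain_boundary (Suc q) (D q) = prism_shell q (D (q - 1))" for q
    proof (cases q)
      case 0
      then show ?thesis using D(1) [of 0] shell0 [of "D 0"] by (simp add: P_def)
    next
      case (Suc p)
      then show ?thesis using D(2) [of p] by (simp add: Q_def)
    qed
  qed
qed

section \<open>Compact deformations and relative homology\<close>

lemma continuous_map_prod_subtopology:
  assumes "continuous_map (prod_topology Z X) U h"
  shows "continuous_map (prod_topology Z (subtopology X T)) U h"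
proof -
  have "prod_topology Z (subtopology X T) = subtopology (prod_topology Z X) (topspace Z \<times> T)"
    by (metis subtopology_Times subtopology_topspace)
  then show ?thesis
    using assms by (simp add: continuous_map_from_subtopology)
qed

text \<open>The boundary of the prism over \<open>c\<close> is the difference of the two images of
  \<open>c\<close> minus the prism over the boundary of \<open>c\<close>. The last term lies in
  \<open>V\<close> because \<open>h\<close> sends \<open>T\<close> into \<open>V\<close> at all
  times.\<close>

lemma coeff_chain_homotopy:
  fixes c :: "('b, 'g::ab_group_add) coeff_chain"
  assumes h: "continuous_map (prod_topology (top_of_set {0..1::real}) X) U h"
    and hV: "\<And>t x. t \<in> {0..1} \<Longrightarrow> x \<in> topspace X \<inter> T \<Longrightarrow> h (t, x) \<in> V"
    and c: "c \<in> coeff_relcycles p X T"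
  shows "coeff_chain_map p (\<lambda>x. h (1, x)) c - coeff_chain_map p (\<lambda>x. h (0, x)) c
    \<in> coeff_relboundaries p U V"
proof -
  obtain D :: "nat \<Rightarrow> (real \<times> (nat \<Rightarrow> real)) chain"
    where D: "\<And>q. singular_chain (Suc q) (prism_space q) (D q)"
      and bD: "\<And>q. chain_boundary (Suc q) (D q) = prism_shell q (D (q - 1))"
    using prism_chains_exist by metis
  have c1: "coeff_singular_chain p X c" and c2: "coeff_singular_chain (p - 1) (subtopology X T) (coeff_boundary p c)"
    using c by (auto simp: coeff_relcycles_def)
  define d where "d = coeff_extend (prism_op (Suc p) (D p) h) c"
  have "singular_chain (Suc p) U (prism_op (Suc p) (D p) h f)" if "f \<in> Poly_Mapping.keys c" for f
    using that c1 by (intro singular_chain_prism_op [OF D _ h]) (auto simp: coeff_singular_chain_def)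
  then have d: "coeff_singular_chain (Suc p) U d"
    unfolding d_def by (rule coeff_singular_chain_extend)
  define e where "e = coeff_extend (prism_op p (D (p - 1)) h) (coeff_boundary p c)"
  have D': "singular_chain p (prism_space (p - 1)) (D (p - 1))" if "0 < p"
    using D [of "p - 1"] that by simp
  have "coeff_boundary (Suc p) d = coeff_extend (\<lambda>f. frag_of (simplex_map p (\<lambda>x. h (1, x)) f)
      - frag_of (simplex_map p (\<lambda>x. h (0, x)) f)
      - frag_extend (prism_op p (D (p - 1)) h) (chain_boundary p (frag_of f))) c"
    unfolding d_def coeff_boundary_of_extend
    by (intro coeff_extend_cong chain_boundary_prism_op D bD D')
  then have "coeff_boundary (Suc p) d
      = coeff_chain_map p (\<lambda>x. h (1, x)) c - coeff_chain_map p (\<lambda>x. h (0, x)) c - e"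
    unfolding e_def coeff_boundary_extend [of p c] coeff_extend_compose coeff_chain_map_def
    by (simp add: coeff_extend_diff_fun)
  moreover have "coeff_singular_chain p (subtopology U V) e"
  proof (cases "p = 0")
    case True
    then show ?thesis by (simp add: e_def coeff_boundary_def)
  next
    case False
    have "continuous_map (prod_topology (top_of_set {0..1::real}) (subtopology X T)) U h"
      using h by (rule continuous_map_prod_subtopology)
    then have "continuous_map (prod_topology (top_of_set {0..1::real}) (subtopology X T)) (subtopology U V) h"
      using hV by (auto simp: continuous_map_in_subtopology)
    then have "singular_chain p (subtopology U V) (prism_op p (D (p - 1)) h f)"
      if "f \<in> Poly_Mapping.keys (coeff_boundary p c)" for f
      using that c2 False by (intro singular_chain_prism_op [OF D']) (auto simp: coeff_singular_chain_def)
    then show ?thesis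
      unfolding e_def by (rule coeff_singular_chain_extend)
  qed
  ultimately show ?thesis
    using d by (auto simp: coeff_relboundaries_def intro!: exI [of _ d])
qed

section \<open>Relative homology as a quotient group\<close>

lemma comm_group_coeff_relcycle_group: "comm_group (coeff_relcycle_group p X T)"
proof (rule comm_groupI)
  fix x :: "('a, 'b) coeff_chain"
  assume "x \<in> carrier (coeff_relcycle_group p X T)"
  then show "\<exists>y\<in>carrier (coeff_relcycle_group p X T). y \<otimes>\<^bsub>coeff_relcycle_group p X T\<^esub> x = \<one>\<^bsub>coeff_relcycle_group p X T\<^esub>"
    by (intro bexI [of _ "- x"]) (auto simp: coeff_relcycle_group_def coeff_relcycles_def coeff_boundary_minus)
qed (auto simp: coeff_relcycle_group_def coeff_relcycles_def coeff_boundary_add add.assoc add.commute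
      intro: coeff_singular_chain_add)

text \<open>Since double boundaries vanish, the boundary of \<open>c\<close> is minus that of the
  remainder, which lies in \<open>T\<close>.\<close>

lemma coeff_relboundary_imp_relcycle:
  assumes "c \<in> coeff_relboundaries p X T"
  shows "c \<in> coeff_relcycles p X T"
proof -
  obtain d where d: "coeff_singular_chain (Suc p) X d"
      and e: "coeff_singular_chain p (subtopology X T) (coeff_boundary (Suc p) d - c)" (is "coeff_singular_chain _ _ ?e")
    using assms by (auto simp: coeff_relboundaries_def)
  have c: "c = coeff_boundary (Suc p) d - ?e"
    by simp
  have "coeff_boundary p c = - coeff_boundary p ?e"
    using coeff_boundary_boundary [OF d] by (subst c) (simp add: coeff_boundary_diff)
  moreover have "coeff_singular_chain p X ?e"
    using e by (simp add: coeff_singular_chain_subtopology)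
  then have "coeff_singular_chain p X c"
    using coeff_singular_chain_boundary [OF d] coeff_singular_chain_diff [of p X "coeff_boundary (Suc p) d" ?e]
    by simp
  ultimately show ?thesis
    using coeff_singular_chain_boundary [OF e] by (simp add: coeff_relcycles_def)
qed

lemma coeff_relboundaries_minus:
  assumes "c \<in> coeff_relboundaries p X T"
  shows "- c \<in> coeff_relboundaries p X T"
proof -
  obtain d where "coeff_singular_chain (Suc p) X d"
      "coeff_singular_chain p (subtopology X T) (coeff_boundary (Suc p) d - c)"
    using assms by (auto simp: coeff_relboundaries_def)
  then show ?thesis
    unfolding coeff_relboundaries_def
    using coeff_singular_chain_minus [of p "subtopology X T" "coeff_boundary (Suc p) d - c"]
    by (auto simp: coeff_boundary_minus intro!: exI [of _ "- d"])
qed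

lemma coeff_relboundaries_add:
  assumes "c \<in> coeff_relboundaries p X T" "c' \<in> coeff_relboundaries p X T"
  shows "c + c' \<in> coeff_relboundaries p X T"
proof -
  obtain d d' where "coeff_singular_chain (Suc p) X d" "coeff_singular_chain (Suc p) X d'"
      and "coeff_singular_chain p (subtopology X T) (coeff_boundary (Suc p) d - c)"
          "coeff_singular_chain p (subtopology X T) (coeff_boundary (Suc p) d' - c')"
    using assms by (auto simp: coeff_relboundaries_def)
  then have "coeff_singular_chain (Suc p) X (d + d')"
    "coeff_singular_chain p (subtopology X T) (coeff_boundary (Suc p) (d + d') - (c + c'))"
    using coeff_singular_chain_add by (auto simp: coeff_boundary_add add_diff_add)
  then show ?thesis
    by (auto simp: coeff_relboundaries_def)
qed

lemma coeff_relboundaries_mono: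
  assumes "P \<subseteq> topspace X" "Q \<subseteq> Y" "c \<in> coeff_relboundaries p (subtopology X P) Q"
  shows "c \<in> coeff_relboundaries p X Y"
proof -
  obtain d where d: "coeff_singular_chain (Suc p) (subtopology X P) d"
      and e: "coeff_singular_chain p (subtopology (subtopology X P) Q) (coeff_boundary (Suc p) d - c)"
    using assms(3) by (auto simp: coeff_relboundaries_def)
  have "coeff_singular_chain (Suc p) X d"
    using d by (simp add: coeff_singular_chain_subtopology)
  moreover have "coeff_singular_chain p (subtopology X Y) (coeff_boundary (Suc p) d - c)"
    using e assms(2) by (simp add: coeff_singular_chain_subtopology) blast
  ultimately show ?thesis
    by (auto simp: coeff_relboundaries_def)
qed

lemma normal_coeff_relboundaries:
  "coeff_relboundaries p X T \<lhd> coeff_relcycle_group p X T"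
proof -
  interpret comm_group "coeff_relcycle_group p X T"
    by (rule comm_group_coeff_relcycle_group)
  have inv: "inv\<^bsub>coeff_relcycle_group p X T\<^esub> c = - c" if "c \<in> coeff_relcycles p X T" for c
  proof (rule inv_equality)
    show "- c \<in> carrier (coeff_relcycle_group p X T)"
      using that by (simp add: coeff_relcycle_group_def coeff_relcycles_def coeff_boundary_minus)
  qed (use that in \<open>auto simp: coeff_relcycle_group_def\<close>)
  have "subgroup (coeff_relboundaries p X T) (coeff_relcycle_group p X T)"
  proof
    show "coeff_relboundaries p X T \<subseteq> carrier (coeff_relcycle_group p X T)"
      using coeff_relboundary_imp_relcycle by (auto simp: coeff_relcycle_group_def)
    show "\<one>\<^bsub>coeff_relcycle_group p X T\<^esub> \<in> coeff_relboundaries p X T"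
      by (auto simp: coeff_relcycle_group_def coeff_relboundaries_def intro: exI [of _ 0])
    show "inv\<^bsub>coeff_relcycle_group p X T\<^esub> c \<in> coeff_relboundaries p X T"
      if "c \<in> coeff_relboundaries p X T" for c
      using that by (simp add: inv coeff_relboundary_imp_relcycle coeff_relboundaries_minus)
  qed (simp add: coeff_relcycle_group_def coeff_relboundaries_add)
  then show ?thesis
    by (simp add: normal_iff_subgroup)
qed

lemma group_coeff_homology_group: "group (coeff_homology_group G p X T)"
  unfolding coeff_homology_group_def
  by (intro normal.factorgroup_is_group normal_coeff_relboundaries)

text \<open>The first isomorphism theorem for \<open>f\<close> followed by the projection modulo
  \<open>K\<close>. Surjectivity is asked only modulo \<open>K\<close>, which is what homologous
  cycles provide.\<close>

lemma FactGroup_iso_FactGroup: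
  assumes N: "N \<lhd> G" and K: "K \<lhd> H" and f: "f \<in> hom G H"
    and surj: "\<And>y. y \<in> carrier H \<Longrightarrow> \<exists>x\<in>carrier G. f x \<in> K #>\<^bsub>H\<^esub> y"
    and ker: "\<And>x. x \<in> carrier G \<Longrightarrow> f x \<in> K \<longleftrightarrow> x \<in> N"
  shows "G Mod N \<cong> H Mod K"
proof -
  interpret N: normal N G by fact
  interpret K: normal K H by fact
  define \<phi> where "\<phi> = (\<lambda>x. K #>\<^bsub>H\<^esub> f x)"
  have fc: "f x \<in> carrier H" if "x \<in> carrier G" for x
    using f that by (auto simp: hom_def)
  have "\<phi> \<in> hom G (H Mod K)"
    using hom_compose [OF f K.r_coset_hom_Mod] by (simp add: \<phi>_def o_def)
  then interpret group_hom G "H Mod K" \<phi>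
    by (simp add: group_hom_def group_hom_axioms_def N.is_group K.factorgroup_is_group)
  have "C \<in> \<phi> ` carrier G" if C: "C \<in> carrier (H Mod K)" for C
  proof -
    obtain y where y: "y \<in> carrier H" "C = K #>\<^bsub>H\<^esub> y"
      using C by (auto simp: FactGroup_def RCOSETS_def)
    obtain x where x: "x \<in> carrier G" "f x \<in> K #>\<^bsub>H\<^esub> y"
      using surj [OF y(1)] by blast
    then have "C = \<phi> x"
      using K.repr_independence [OF x(2) y(1)] K.subgroup_axioms by (simp add: y(2) \<phi>_def)
    with x show ?thesis by blast
  qed
  then have "\<phi> ` carrier G = carrier (H Mod K)"
    using hom_closed by blast
  moreover have "kernel G (H Mod K) \<phi> = N"
  proof -
    have "\<phi> x = K \<longleftrightarrow> x \<in> N" if "x \<in> carrier G" for x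
      unfolding \<phi>_def ker [OF that, symmetric]
      using K.coset_join1 K.coset_join2 K.subgroup_axioms fc [OF that] K.subset by blast
    then show ?thesis
      using N.subset by (auto simp: kernel_def)
  qed
  ultimately show ?thesis
    using FactGroup_iso by simp
qed

section \<open>Compact supports and deformation of compact parts\<close>

definition chain_support :: "nat \<Rightarrow> ('a, 'g::ab_group_add) coeff_chain \<Rightarrow> 'a set"
  where "chain_support p c = (\<Union>f\<in>Poly_Mapping.keys c. f ` standard_simplex p)"

text \<open>A chain involves finitely many simplices, each of them the continuous image of a compact
  standard simplex.\<close>

lemma compactin_chain_support:
  assumes "coeff_singular_chain p X c"
  shows "compactin X (chain_support p c)"
proof -
  have "compactin (std_simplex_space p) (standard_simplex p)"
    by (simp add: compactin_subtopology compactin_standard_simplex del: compactin_euclidean_iff)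
  then have "compactin X (f ` standard_simplex p)" if "f \<in> Poly_Mapping.keys c" for f
    using assms that image_compactin [of "std_simplex_space p" "standard_simplex p" X f]
    by (auto simp: coeff_singular_chain_def singular_simplex_def)
  then show ?thesis
    unfolding chain_support_def by (intro compactin_Union) auto
qed

lemma coeff_singular_chain_support:
  "coeff_singular_chain p (subtopology X T) c \<longleftrightarrow> coeff_singular_chain p X c \<and> chain_support p c \<subseteq> T"
  by (auto simp: coeff_singular_chain_subtopology chain_support_def)

lemma coeff_singular_chain_push:
  assumes c: "coeff_singular_chain p X c" and g: "continuous_map X Y g"
    and "g ` chain_support p c \<subseteq> T"
  shows "coeff_singular_chain p (subtopology Y T) (coeff_chain_map p g c)"
proof (rule coeff_singular_chain_map [OF c])
  fix f
  assume f: "f \<in> Poly_Mapping.keys c"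
  then have "singular_simplex p Y (simplex_map p g f)"
    using c g by (auto simp: coeff_singular_chain_def intro: singular_simplex_simplex_map)
  moreover have "simplex_map p g f ` standard_simplex p \<subseteq> T"
    using f assms(3) by (auto simp: simplex_map_def chain_support_def)
  ultimately show "singular_simplex p (subtopology Y T) (simplex_map p g f)"
    by (simp add: singular_simplex_subtopology)
qed

text \<open>Singular chains have compact support, so it suffices that every compact part of \<open>(X, Y)\<close>
  can be deformed into \<open>(P, Q)\<close>; the deformation may depend on that compact part.\<close>

theorem coeff_homology_iso_compact_deformation:
  assumes P: "P \<subseteq> topspace X" and Q: "Q \<subseteq> P" "Q \<subseteq> Y"
    and deform: "\<And>K L. \<lbrakk>compactin X K; compactin X L; L \<subseteq> Y\<rbrakk> \<Longrightarrow>
      \<exists>h. continuous_map (prod_topology (top_of_set {0..1::real}) X) X h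
        \<and> (\<forall>x\<in>topspace X. h (0, x) = x)
        \<and> (\<forall>t\<in>{0..1}. (\<forall>x\<in>P. h (t, x) \<in> P) \<and> (\<forall>x\<in>Q. h (t, x) \<in> Q) \<and> (\<forall>x\<in>topspace X \<inter> Y. h (t, x) \<in> Y))
        \<and> (\<forall>x\<in>K. h (1, x) \<in> P) \<and> (\<forall>x\<in>L. h (1, x) \<in> Q)"
  shows "coeff_homology_group TYPE('g::ab_group_add) p (subtopology X P) Q
    \<cong> coeff_homology_group TYPE('g) p X Y"
proof -
  let ?XP = "subtopology X P"
  have subQ: "subtopology ?XP Q = subtopology X Q"
    using Q(1) by (simp add: subtopology_subtopology inf.absorb2)
  have sub_relcycles: "c \<in> coeff_relcycles p X Y" if "c \<in> coeff_relcycles p ?XP Q" for c :: "('a, 'g) coeff_chain"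
    using that Q(2) by (auto simp: coeff_relcycles_def subQ coeff_singular_chain_support)
  have cont1: "continuous_map X X (\<lambda>x. h (s, x))"
    if "continuous_map (prod_topology (top_of_set {0..1::real}) X) X h" "s \<in> {0..1::real}" for h s
  proof -
    have "continuous_map X (prod_topology (top_of_set {0..1::real}) X) (Pair s)"
      using that(2) by (simp add: continuous_map_pairwise o_def)
    from continuous_map_compose [OF this that(1)] show ?thesis
      by (simp add: o_def)
  qed
  \<comment> \<open>Surjectivity: a relative cycle is homologous in the large pair to its image
    under the final map of the deformation, which lies in the small pair.\<close>
  have surj: "\<exists>c'\<in>coeff_relcycles p ?XP Q. c' - c \<in> coeff_relboundaries p X Y"
    if "c \<in> coeff_relcycles p X Y" for c :: "('a, 'g) coeff_chain"
  proof -
    have c: "coeff_singular_chain p X c" "coeff_singular_chain (p - 1) (subtopology X Y) (coeff_boundary p c)"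
      using that by (auto simp: coeff_relcycles_def)
    then have bc: "coeff_singular_chain (p - 1) X (coeff_boundary p c)" "chain_support (p - 1) (coeff_boundary p c) \<subseteq> Y"
      by (auto simp: coeff_singular_chain_support)
    \<comment> \<open>One deformation has to serve the chain and its boundary together: the chain
      goes to \<open>P\<close>, its boundary, which lies in \<open>Y\<close>, to
      \<open>Q\<close>.\<close>
    obtain h where h: "continuous_map (prod_topology (top_of_set {0..1::real}) X) X h"
        "\<forall>x\<in>topspace X. h (0, x) = x" "\<forall>t\<in>{0..1}. \<forall>x\<in>topspace X \<inter> Y. h (t, x) \<in> Y"
        "\<forall>x\<in>chain_support p c. h (1, x) \<in> P" "\<forall>x\<in>chain_support (p - 1) (coeff_boundary p c). h (1, x) \<in> Q"
      using deform [OF compactin_chain_support [OF c(1)] compactin_chain_support [OF bc(1)] bc(2)] by blast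
    define c' where "c' = coeff_chain_map p (\<lambda>x. h (1, x)) c"
    have "c' - coeff_chain_map p (\<lambda>x. h (0, x)) c \<in> coeff_relboundaries p X Y"
      unfolding c'_def using h(3) by (intro coeff_chain_homotopy [OF h(1) _ that]) auto
    moreover have "coeff_chain_map p (\<lambda>x. h (0, x)) c = c"
      using h(2) by (intro coeff_chain_map_ident [OF c(1)]) auto
    moreover have "coeff_boundary p c' = coeff_chain_map (p - 1) (\<lambda>x. h (1, x)) (coeff_boundary p c)"
      unfolding c'_def by (rule coeff_boundary_chain_map [OF c(1)])
    then have "coeff_singular_chain (p - 1) (subtopology X Q) (coeff_boundary p c')"
      using coeff_singular_chain_push [OF bc(1) cont1 [OF h(1)], of 1 Q] h(5) by auto
    moreover have "coeff_singular_chain p ?XP c'"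
      unfolding c'_def using coeff_singular_chain_push [OF c(1) cont1 [OF h(1)], of 1 P] h(4) by auto
    ultimately show ?thesis
      by (auto simp: coeff_relcycles_def subQ)
  qed
  \<comment> \<open>Injectivity: pushing the bounding chain and the remainder shows that the image
    of \<open>c\<close> bounds in the small pair.\<close>
  have inj: "c \<in> coeff_relboundaries p ?XP Q"
    if c: "c \<in> coeff_relcycles p ?XP Q" and bd: "c \<in> coeff_relboundaries p X Y" for c :: "('a, 'g) coeff_chain"
  proof -
    obtain d where d: "coeff_singular_chain (Suc p) X d"
        and "coeff_singular_chain p (subtopology X Y) (coeff_boundary (Suc p) d - c)" (is "coeff_singular_chain _ _ ?e")
      using bd by (auto simp: coeff_relboundaries_def)
    then have e: "coeff_singular_chain p X ?e" "chain_support p ?e \<subseteq> Y"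
      by (auto simp: coeff_singular_chain_support)
    obtain h where h: "continuous_map (prod_topology (top_of_set {0..1::real}) X) X h"
        "\<forall>x\<in>topspace X. h (0, x) = x" "\<forall>t\<in>{0..1}. \<forall>x\<in>P. h (t, x) \<in> P" "\<forall>t\<in>{0..1}. \<forall>x\<in>Q. h (t, x) \<in> Q"
        "\<forall>x\<in>chain_support (Suc p) d. h (1, x) \<in> P" "\<forall>x\<in>chain_support p ?e. h (1, x) \<in> Q"
      using deform [OF compactin_chain_support [OF d] compactin_chain_support [OF e(1)] e(2)] by blast
    let ?g = "\<lambda>x. h (1, x)"
    \<comment> \<open>The homotopy restricts to \<open>P\<close> and preserves \<open>Q\<close>, so
      \<open>c\<close> and its image are homologous within the small pair.\<close>
    have hP: "continuous_map (prod_topology (top_of_set {0..1::real}) ?XP) ?XP h"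
      using continuous_map_prod_subtopology [OF h(1), of P] h(3)
      by (auto simp: continuous_map_in_subtopology)
    have cP: "coeff_singular_chain p ?XP c"
      using c by (auto simp: coeff_relcycles_def)
    have "coeff_chain_map p ?g c - coeff_chain_map p (\<lambda>x. h (0, x)) c \<in> coeff_relboundaries p ?XP Q"
      using h(4) by (intro coeff_chain_homotopy [OF hP _ c]) auto
    moreover have "coeff_chain_map p (\<lambda>x. h (0, x)) c = c"
      using h(2) by (intro coeff_chain_map_ident [OF cP]) auto
    moreover have "coeff_chain_map p ?g c \<in> coeff_relboundaries p ?XP Q"
    proof -
      have "coeff_boundary (Suc p) (coeff_chain_map (Suc p) ?g d) - coeff_chain_map p ?g c
          = coeff_chain_map p ?g ?e"
        by (simp add: coeff_boundary_chain_map [OF d] coeff_chain_map_diff)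
      moreover have "coeff_singular_chain (Suc p) ?XP (coeff_chain_map (Suc p) ?g d)"
        using coeff_singular_chain_push [OF d cont1 [OF h(1)], of 1 P] h(5) by auto
      moreover have "coeff_singular_chain p (subtopology X Q) (coeff_chain_map p ?g ?e)"
        using coeff_singular_chain_push [OF e(1) cont1 [OF h(1)], of 1 Q] h(6) by auto
      ultimately show ?thesis
        by (auto simp: coeff_relboundaries_def subQ intro!: exI [of _ "coeff_chain_map (Suc p) ?g d"])
    qed
    ultimately have "coeff_chain_map p ?g c + - (coeff_chain_map p ?g c - c) \<in> coeff_relboundaries p ?XP Q"
      using coeff_relboundaries_add coeff_relboundaries_minus by metis
    then show ?thesis by simp
  qed
  show ?thesis
    unfolding coeff_homology_group_def
  proof (rule FactGroup_iso_FactGroup [where f = id])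
    show "id \<in> hom (coeff_relcycle_group p ?XP Q) (coeff_relcycle_group p X Y :: ('a, 'g) coeff_chain monoid)"
      using sub_relcycles by (auto simp: hom_def coeff_relcycle_group_def)
    show "\<exists>x\<in>carrier (coeff_relcycle_group p ?XP Q). id x \<in> coeff_relboundaries p X Y #>\<^bsub>coeff_relcycle_group p X Y\<^esub> y"
      if y: "y \<in> carrier (coeff_relcycle_group p X Y)" for y :: "('a, 'g) coeff_chain"
    proof -
      obtain c' where "c' \<in> coeff_relcycles p ?XP Q" "c' - y \<in> coeff_relboundaries p X Y"
        using surj y by (auto simp: coeff_relcycle_group_def)
      moreover from this(2) have "c' \<in> coeff_relboundaries p X Y #>\<^bsub>coeff_relcycle_group p X Y\<^esub> y"
        by (auto simp: coeff_relcycle_group_def r_coset_def intro!: bexI [of _ "c' - y"])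
      ultimately show ?thesis
        by (auto simp: coeff_relcycle_group_def)
    qed
    show "id x \<in> coeff_relboundaries p X Y \<longleftrightarrow> x \<in> coeff_relboundaries p ?XP Q"
      if "x \<in> carrier (coeff_relcycle_group p ?XP Q)" for x :: "('a, 'g) coeff_chain"
      using inj that coeff_relboundaries_mono [OF P Q(2)] by (auto simp: coeff_relcycle_group_def)
  qed (rule normal_coeff_relboundaries)+
qed

section \<open>Semiflows\<close>

lemma semiflow_add: "\<lbrakk>semiflow S; 0 \<le> t; 0 \<le> s\<rbrakk> \<Longrightarrow> S t (S s x) = S (t + s) x"
  by (simp add: semiflow_def)

lemma continuous_on_semiflow:
  assumes S: "semiflow S" and f: "continuous_on Z f" and g: "continuous_on Z g"
    and nonneg: "\<And>z. z \<in> Z \<Longrightarrow> 0 \<le> f z"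
  shows "continuous_on Z (\<lambda>z. S (f z) (g z))"
proof -
  have "continuous_on ({0..} \<times> UNIV) (\<lambda>(t, x). S t x)"
    using S by (simp add: semiflow_def)
  moreover have "continuous_on Z (\<lambda>z. (f z, g z))"
    using f g by (rule continuous_on_Pair)
  moreover have "(\<lambda>z. (f z, g z)) ` Z \<subseteq> {0..} \<times> UNIV"
    using nonneg by auto
  ultimately have "continuous_on Z (\<lambda>z. case (f z, g z) of (t, x) \<Rightarrow> S t x)"
    by (rule continuous_on_compose2)
  then show ?thesis
    by simp
qed

lemma positively_invariantD: "\<lbrakk>positively_invariant S X; x \<in> X; 0 \<le> t\<rbrakk> \<Longrightarrow> S t x \<in> X"
  by (auto simp: positively_invariant_def)

lemma positively_invariant_Int:
  "\<lbrakk>positively_invariant S X; positively_invariant S Y\<rbrakk> \<Longrightarrow> positively_invariant S (X \<inter> Y)"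
  unfolding positively_invariant_def by blast

lemma invariant_imp_positively_invariant: "invariant S X \<Longrightarrow> positively_invariant S X"
  by (auto simp: invariant_def positively_invariant_def)

lemma semiflow_homotopy:
  assumes S: "semiflow S" and X: "positively_invariant S X" and T: "0 \<le> T"
  shows "continuous_map (prod_topology (top_of_set {0..1::real}) (top_of_set X)) (top_of_set X)
    (\<lambda>(t, x). S (t * T) x)"
proof -
  have "continuous_on ({0..1} \<times> X) (\<lambda>z. S (fst z * T) (snd z))"
    using T by (intro continuous_on_semiflow [OF S]) (auto intro!: continuous_intros)
  moreover have "S (t * T) x \<in> X" if "t \<in> {0..1}" "x \<in> X" for t x
    using positively_invariantD [OF X] T that by simp
  ultimately show ?thesis
    by (auto simp: case_prod_unfold)
qed

text \<open>Compactness of \<open>A\<close> gives a uniform distance from \<open>A\<close> within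
  which all points lie in the interior of \<open>N\<close>.\<close>

lemma attraction_basin_enters:
  assumes A: "compact A" "A \<subseteq> interior N" and x: "x \<in> attraction_basin S A"
  shows "\<forall>\<^sub>F t in at_top. S t x \<in> interior N"
proof -
  obtain e where e: "0 < e" "(\<Union>a\<in>A. ball a e) \<subseteq> interior N"
    using compact_subset_open_imp_ball_epsilon_subset [OF A(1) open_interior A(2)] by blast
  have "A \<noteq> {}" "((\<lambda>t. infdist (S t x) A) \<longlongrightarrow> 0) at_top"
    using x by (auto simp: attraction_basin_def)
  then have "\<forall>\<^sub>F t in at_top. infdist (S t x) A < e"
    using e(1) order_tendstoD(2) by blast
  moreover have "y \<in> interior N" if lt: "infdist y A < e" for y
  proof -
    have "\<not> (\<forall>a\<in>A. e \<le> dist y a)"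
      using lt cINF_greatest [OF \<open>A \<noteq> {}\<close>, of e "dist y"] \<open>A \<noteq> {}\<close>
      by (simp add: infdist_notempty) blast
    then obtain a where "a \<in> A" "dist y a < e"
      by (auto simp: not_le)
    then have "y \<in> (\<Union>a\<in>A. ball a e)"
      by (auto simp: dist_commute)
    with e(2) show ?thesis
      by blast
  qed
  ultimately show ?thesis
    by (auto elim: eventually_mono)
qed

text \<open>Each point reaches the interior of \<open>N\<close> at some time, and nearby points are
  there at the same time. Finitely many such times suffice for \<open>K\<close>, and positive
  invariance of \<open>N\<close> keeps all later images inside.\<close>

lemma compact_absorbed:
  assumes S: "semiflow S" and N: "positively_invariant S N" and A: "compact A" "A \<subseteq> interior N"
    and K: "compact K" "K \<subseteq> attraction_basin S A"
  obtains T where "0 \<le> T" "\<And>t. T \<le> t \<Longrightarrow> S t ` K \<subseteq> N"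
proof -
  have "\<exists>t\<ge>0. S t x \<in> interior N" if x: "x \<in> K" for x
  proof -
    obtain N0 where "\<And>t. N0 \<le> t \<Longrightarrow> S t x \<in> interior N"
      using attraction_basin_enters [OF A, of x S] x K(2) unfolding eventually_at_top_linorder by blast
    from this [of "max 0 N0"] show ?thesis
      by (intro exI [of _ "max 0 N0"]) simp
  qed
  then obtain \<tau> where \<tau>: "\<And>x. x \<in> K \<Longrightarrow> 0 \<le> \<tau> x" "\<And>x. x \<in> K \<Longrightarrow> S (\<tau> x) x \<in> interior N"
    by metis
  have "open (S (\<tau> x) -` interior N)" if "x \<in> K" for x
    using \<tau>(1) [OF that] by (intro open_vimage continuous_on_semiflow [OF S]) auto
  moreover have "K \<subseteq> (\<Union>x\<in>K. S (\<tau> x) -` interior N)"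
    using \<tau>(2) by auto
  ultimately obtain F where F: "F \<subseteq> K" "finite F" "K \<subseteq> (\<Union>x\<in>F. S (\<tau> x) -` interior N)"
    by (rule compactE_image [OF K(1)])
  \<comment> \<open>The inserted 0 covers the case of an empty \<open>F\<close> and ensures
    \<open>0 \<le> T\<close>.\<close>
  define T where "T = Max (insert 0 (\<tau> ` F))"
  have T: "0 \<le> T" "\<And>x. x \<in> F \<Longrightarrow> \<tau> x \<le> T"
    unfolding T_def using F(2) by auto
  have "S t y \<in> N" if t: "T \<le> t" and y: "y \<in> K" for t y
  proof -
    obtain x where x: "x \<in> F" "S (\<tau> x) y \<in> N"
      using F(3) y interior_subset by blast
    have le: "\<tau> x \<le> t" "0 \<le> \<tau> x"
      using T(2) [OF x(1)] t \<tau>(1) F(1) x(1) by auto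
    then have "S t y = S (t - \<tau> x) (S (\<tau> x) y)"
      by (simp add: semiflow_add [OF S])
    moreover have "S (t - \<tau> x) (S (\<tau> x) y) \<in> N"
      using positively_invariantD [OF N x(2)] le(1) by simp
    ultimately show ?thesis
      by simp
  qed
  with T(1) that show thesis by blast
qed

text \<open>The flow up to a large common time deforms any compact part into \<open>(P, Q)\<close>,
  and positive invariance keeps all four sets stable meanwhile. Attraction to \<open>B\<close> is
  asked on \<open>X \<inter> Y\<close>, since the pair is read as
  \<open>(X, X \<inter> Y)\<close>.\<close>

lemma coeff_homology_iso_absorbed:
  assumes S: "semiflow S"
    and inv: "positively_invariant S X" "positively_invariant S Y" "positively_invariant S P" "positively_invariant S Q"
    and sub: "P \<subseteq> X" "Q \<subseteq> P" "Q \<subseteq> Y"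
    and A: "compact A" "A \<subseteq> interior P" "X \<subseteq> attraction_basin S A"
    and B: "compact B" "B \<subseteq> interior Q" "X \<inter> Y \<subseteq> attraction_basin S B"
  shows "coeff_homology_group TYPE('g::ab_group_add) p (top_of_set P) Q
    \<cong> coeff_homology_group TYPE('g) p (top_of_set X) Y"
proof -
  have "coeff_homology_group TYPE('g) p (subtopology (top_of_set X) P) Q
      \<cong> coeff_homology_group TYPE('g) p (top_of_set X) Y"
  proof (rule coeff_homology_iso_compact_deformation)
    fix K L
    assume "compactin (top_of_set X) K" "compactin (top_of_set X) L" and "L \<subseteq> Y"
    then have K: "compact K" "K \<subseteq> attraction_basin S A" and L: "compact L" "L \<subseteq> attraction_basin S B"
      using A(3) B(3) by (auto simp: compactin_subtopology)
    obtain T1 where T1: "0 \<le> T1" "\<And>t. T1 \<le> t \<Longrightarrow> S t ` K \<subseteq> P"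
      using compact_absorbed [OF S inv(3) A(1,2) K] by blast
    obtain T2 where T2: "0 \<le> T2" "\<And>t. T2 \<le> t \<Longrightarrow> S t ` L \<subseteq> Q"
      using compact_absorbed [OF S inv(4) B(1,2) L] by blast
    define T where "T = max T1 T2"
    have T: "0 \<le> T" "S T ` K \<subseteq> P" "S T ` L \<subseteq> Q"
      using T1 T2 by (auto simp: T_def)
    define h where "h = (\<lambda>(t::real, x). S (t * T) x)"
    have "continuous_map (prod_topology (top_of_set {0..1}) (top_of_set X)) (top_of_set X) h"
      unfolding h_def by (rule semiflow_homotopy [OF S inv(1) T(1)])
    moreover have "h (0, x) = x" for x
      using S by (simp add: h_def semiflow_def)
    moreover have "h (t, x) \<in> Z" if "positively_invariant S Z" "t \<in> {0..1}" "x \<in> Z" for t x Z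
      using positively_invariantD [OF that(1,3)] that(2) T(1) by (simp add: h_def)
    moreover have "\<forall>x\<in>K. h (1, x) \<in> P" "\<forall>x\<in>L. h (1, x) \<in> Q"
      using T by (auto simp: h_def)
    ultimately show "\<exists>h. continuous_map (prod_topology (top_of_set {0..1::real}) (top_of_set X)) (top_of_set X) h
        \<and> (\<forall>x\<in>topspace (top_of_set X). h (0, x) = x)
        \<and> (\<forall>t\<in>{0..1}. (\<forall>x\<in>P. h (t, x) \<in> P) \<and> (\<forall>x\<in>Q. h (t, x) \<in> Q) \<and> (\<forall>x\<in>topspace (top_of_set X) \<inter> Y. h (t, x) \<in> Y))
        \<and> (\<forall>x\<in>K. h (1, x) \<in> P) \<and> (\<forall>x\<in>L. h (1, x) \<in> Q)"
      using inv by - (rule exI [of _ h], auto)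
  qed (use sub in auto)
  then show ?thesis
    using sub(1) by (simp add: subtopology_subtopology inf.absorb2)
qed

section \<open>Attraction basins and omega-limit sets\<close>

lemma attracted_sequence_subseq:
  fixes u :: "nat \<Rightarrow> 'a::metric_space"
  assumes A: "compact A" "A \<noteq> {}" and u: "(\<lambda>n. infdist (u n) A) \<longlonglongrightarrow> 0"
  obtains r y where "strict_mono r" "y \<in> A" "(\<lambda>n. u (r n)) \<longlonglongrightarrow> y"
proof -
  \<comment> \<open>Nearest points in \<open>A\<close> exist by compactness; a convergent
    subsequence of them drags \<open>u\<close> along.\<close>
  have "\<exists>a\<in>A. infdist (u n) A = dist (u n) a" for n
  proof -
    have "\<exists>a\<in>A. \<forall>b\<in>A. dist (u n) a \<le> dist (u n) b"
      using A by (intro continuous_attains_inf) (auto intro: continuous_intros)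
    then obtain a where a: "a \<in> A" "\<And>b. b \<in> A \<Longrightarrow> dist (u n) a \<le> dist (u n) b"
      by blast
    then have "dist (u n) a \<le> infdist (u n) A"
      using A(2) by (simp add: infdist_notempty cINF_greatest)
    with a(1) show ?thesis
      using infdist_le [OF a(1)] by (intro bexI [of _ a]) (auto intro: order_antisym)
  qed
  then obtain a where a: "\<And>n. a n \<in> A" "\<And>n. infdist (u n) A = dist (u n) (a n)"
    by metis
  obtain y r where y: "y \<in> A" "strict_mono r" "(a \<circ> r) \<longlonglongrightarrow> y"
    using A(1) a(1) unfolding compact_def by metis
  have "(\<lambda>n. dist (u (r n)) (a (r n)) + dist (a (r n)) y) \<longlonglongrightarrow> 0 + 0"
    using LIMSEQ_subseq_LIMSEQ [OF u y(2)] y(3)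
    by (intro tendsto_add) (simp_all add: a(2) o_def tendsto_dist_iff [of _ y])
  then have "(\<lambda>n. u (r n)) \<longlonglongrightarrow> y"
    unfolding tendsto_dist_iff [of _ y]
    by (intro tendsto_sandwich [OF _ _ tendsto_const, of 0 "\<lambda>n. dist (u (r n)) y"])
       (auto simp: dist_triangle)
  with y that show thesis by blast
qed

lemma attraction_basin_positively_invariant:
  assumes S: "semiflow S"
  shows "positively_invariant S (attraction_basin S A)"
  unfolding positively_invariant_def
proof (intro allI impI subsetI)
  fix s y
  assume s: "(0::real) \<le> s" and "y \<in> S s ` attraction_basin S A"
  then obtain x where x: "A \<noteq> {}" "((\<lambda>t. infdist (S t x) A) \<longlongrightarrow> 0) at_top" and y: "y = S s x"
    by (auto simp: attraction_basin_def)
  have "filterlim (\<lambda>t. t + s) at_top at_top"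
    unfolding add.commute [of _ s]
    by (intro filterlim_tendsto_add_at_top [OF tendsto_const] filterlim_ident)
  from filterlim_compose [OF x(2) this] have "((\<lambda>t. infdist (S (t + s) x) A) \<longlongrightarrow> 0) at_top" .
  moreover have "\<forall>\<^sub>F t in at_top. infdist (S (t + s) x) A = infdist (S t y) A"
    using s unfolding y
    by (intro eventually_mono [OF eventually_ge_at_top [of 0]]) (simp add: semiflow_add [OF S])
  ultimately have "((\<lambda>t. infdist (S t y) A) \<longlongrightarrow> 0) at_top"
    by (rule Lim_transform_eventually)
  with x(1) show "y \<in> attraction_basin S A"
    by (simp add: attraction_basin_def)
qed

text \<open>Uniform attraction of a neighborhood attracts each of its points, so that neighborhood
  lies in the basin.\<close>

lemma attractor_subset_interior_basin:
  assumes "attractor S A" "A \<noteq> {}"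
  shows "A \<subseteq> interior (attraction_basin S A)"
proof -
  obtain U where U: "closure A \<subseteq> interior U" "attracts S A U"
    using assms(1) by (auto simp: attractor_in_def neighborhood_iff)
  have "x \<in> attraction_basin S A" if "x \<in> U" for x
  proof -
    have "\<forall>\<^sub>F t in at_top. dist (infdist (S t x) A) 0 < e" if "0 < e" for e
    proof -
      obtain T where "\<And>t. T < t \<Longrightarrow> S t ` U \<subseteq> eps_ball A e"
        using U(2) \<open>0 < e\<close> unfolding attracts_def by blast
      then have "dist (infdist (S t x) A) 0 < e" if "T < t" for t
        using \<open>x \<in> U\<close> that by (force simp: eps_ball_def infdist_nonneg)
      then show ?thesis
        by (auto intro: eventually_mono [OF eventually_gt_at_top [of T]])
    qed
    then show ?thesis
      using assms(2) by (auto simp: attraction_basin_def intro: tendstoI)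
  qed
  then have "interior U \<subseteq> interior (attraction_basin S A)"
    by (intro interior_mono) auto
  with U(1) closure_subset [of A] show ?thesis
    by blast
qed

lemma omega_limit_semiflow:
  assumes S: "semiflow S" and y: "y \<in> omega_limit S x" and s: "0 \<le> s"
  shows "S s y \<in> omega_limit S x"
proof -
  obtain t where t: "\<And>n. 0 \<le> t n" "filterlim t at_top sequentially" "(\<lambda>n. S (t n) x) \<longlonglongrightarrow> y"
    using y by (auto simp: omega_limit_def)
  have "continuous_on UNIV (S s)"
    using s by (intro continuous_on_semiflow [OF S, where f = "\<lambda>_. s" and g = "\<lambda>z. z"]) auto
  then have "(\<lambda>n. S s (S (t n) x)) \<longlonglongrightarrow> S s y"
    using t(3) by (rule continuous_on_tendsto_compose) auto
  moreover have "S s (S (t n) x) = S (s + t n) x" for n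
    using s t(1) by (simp add: semiflow_add [OF S])
  moreover have "filterlim (\<lambda>n. s + t n) at_top sequentially"
    using t(2) by (intro filterlim_tendsto_add_at_top [OF tendsto_const])
  ultimately show ?thesis
    using s t(1) by (auto simp: omega_limit_def intro!: exI [of _ "\<lambda>n. s + t n"])
qed

lemma omega_limit_shift:
  assumes S: "semiflow S" and s: "0 \<le> s"
  shows "omega_limit S (S s x) \<subseteq> omega_limit S x"
proof
  fix y
  assume "y \<in> omega_limit S (S s x)"
  then obtain t where t: "\<And>n. 0 \<le> t n" "filterlim t at_top sequentially" "(\<lambda>n. S (t n) (S s x)) \<longlonglongrightarrow> y"
    by (auto simp: omega_limit_def)
  moreover have "S (t n) (S s x) = S (s + t n) x" for n
    using s t(1) by (simp add: semiflow_add [OF S] add.commute)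
  moreover have "filterlim (\<lambda>n. s + t n) at_top sequentially"
    using t(2) by (intro filterlim_tendsto_add_at_top [OF tendsto_const])
  ultimately show "y \<in> omega_limit S x"
    using s by (auto simp: omega_limit_def intro!: exI [of _ "\<lambda>n. s + t n"])
qed

text \<open>A trajectory tending to a compact set is precompact along any times tending to
  infinity.\<close>

lemma attracted_omega_limit:
  assumes A: "compact A" and x: "x \<in> attraction_basin S A"
    and t: "\<And>n. 0 \<le> t n" "filterlim t at_top sequentially"
  obtains r y where "strict_mono r" "y \<in> A" "y \<in> omega_limit S x" "(\<lambda>n. S (t (r n)) x) \<longlonglongrightarrow> y"
proof -
  have "A \<noteq> {}" and lim: "((\<lambda>t. infdist (S t x) A) \<longlongrightarrow> 0) at_top"
    using x by (auto simp: attraction_basin_def)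
  obtain r y where r: "strict_mono r" "y \<in> A" "(\<lambda>n. S (t (r n)) x) \<longlonglongrightarrow> y"
    using attracted_sequence_subseq [OF A \<open>A \<noteq> {}\<close> filterlim_compose [OF lim t(2)]] by metis
  have "filterlim (\<lambda>n. t (r n)) at_top sequentially"
    using filterlim_compose [OF t(2) filterlim_subseq [OF r(1)]] by simp
  with r(3) t(1) have "y \<in> omega_limit S x"
    by (auto simp: omega_limit_def intro!: exI [of _ "\<lambda>n. t (r n)"])
  with r that show thesis by blast
qed

lemma omega_limit_nonempty:
  assumes "compact A" "x \<in> attraction_basin S A"
  shows "omega_limit S x \<inter> A \<noteq> {}"
proof -
  obtain y where "y \<in> A" "y \<in> omega_limit S x"
    by (rule attracted_omega_limit [OF assms, of "\<lambda>n. real n"])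
       (auto simp: filterlim_real_sequentially)
  then show ?thesis by blast
qed

lemma omega_limit_subset:
  assumes "closed A" "x \<in> attraction_basin S A"
  shows "omega_limit S x \<subseteq> A"
proof
  fix y
  assume "y \<in> omega_limit S x"
  then obtain t where t: "filterlim t at_top sequentially" "(\<lambda>n. S (t n) x) \<longlonglongrightarrow> y"
    by (auto simp: omega_limit_def)
  have "A \<noteq> {}" and lim: "((\<lambda>t. infdist (S t x) A) \<longlongrightarrow> 0) at_top"
    using assms(2) by (auto simp: attraction_basin_def)
  have "infdist y A = 0"
    using LIMSEQ_unique [OF tendsto_infdist [OF t(2)] filterlim_compose [OF lim t(1)]] .
  then show "y \<in> A"
    using in_closed_iff_infdist_zero [OF assms(1) \<open>A \<noteq> {}\<close>] by blast
qed

text \<open>If the trajectory were at distance at least \<open>e\<close> from \<open>B\<close> at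
  arbitrarily late times, some omega-limit point would have that distance too. Locating the
  omega-limit set therefore locates the basin.\<close>

lemma omega_limit_subset_imp_basin:
  assumes A: "compact A" and x: "x \<in> attraction_basin S A" and B: "omega_limit S x \<subseteq> B"
  shows "x \<in> attraction_basin S B"
proof -
  have "\<forall>\<^sub>F t in at_top. infdist (S t x) B < e" if "0 < e" for e
  proof (rule ccontr)
    assume "\<not> ?thesis"
    then have "\<forall>N. \<exists>t\<ge>N. e \<le> infdist (S t x) B"
      by (auto simp: eventually_at_top_linorder not_less)
    then have "\<exists>t. \<forall>n. real n \<le> t n \<and> e \<le> infdist (S (t n) x) B"
      by (intro choice) auto
    then obtain t where t: "\<And>n::nat. real n \<le> t n" "\<And>n. e \<le> infdist (S (t n) x) B"
      by blast
    have "filterlim t at_top sequentially"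
      using t(1) by (intro filterlim_at_top_mono [OF filterlim_real_sequentially]) auto
    moreover have "0 \<le> t n" for n
      using t(1) [of n] by (rule order_trans [OF of_nat_0_le_iff])
    ultimately obtain r y where y: "y \<in> omega_limit S x" "(\<lambda>n. S (t (r n)) x) \<longlonglongrightarrow> y"
      using attracted_omega_limit [OF A x, of t] by metis
    have "e \<le> infdist y B"
      using t(2) by (intro tendsto_lowerbound [OF tendsto_infdist [OF y(2)]]) auto
    then show False
      using y(1) B \<open>0 < e\<close> by auto
  qed
  then have "((\<lambda>t. infdist (S t x) B) \<longlongrightarrow> 0) at_top"
    by (intro tendstoI) (simp add: infdist_nonneg)
  \<comment> \<open>The distance to the empty set is 0 by convention, so nonemptiness needs an
    argument of its own.\<close>
  moreover have "B \<noteq> {}"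
    using omega_limit_nonempty [OF A x] B by blast
  ultimately show ?thesis
    by (simp add: attraction_basin_def)
qed

lemma closed_positively_invariant_omega_limit:
  assumes "closed A" "positively_invariant S A" "x \<in> A"
  shows "omega_limit S x \<subseteq> A"
proof
  fix y
  assume "y \<in> omega_limit S x"
  then obtain t where t: "\<And>n::nat. 0 \<le> t n" "(\<lambda>n. S (t n) x) \<longlonglongrightarrow> y"
    by (auto simp: omega_limit_def)
  have "S (t n) x \<in> A" for n
    using assms(2,3) t(1) by (rule positively_invariantD)
  then show "y \<in> A"
    using closed_sequentially [OF assms(1) _ t(2)] by blast
qed

section \<open>Morse decompositions and Lyapunov functions\<close>

context
  fixes S :: "real \<Rightarrow> 'a::metric_space \<Rightarrow> 'a"
    and \<AA> :: "'a set" and l :: nat and A M :: "nat \<Rightarrow> 'a set"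
    and V :: "'a \<Rightarrow> real"
  assumes semiflow: "semiflow S"
    and attractor: "attractor S \<AA>"
    and morse: "morse_decomposition S \<AA> l A M"
    and lyapunov: "strict_morse_lyapunov S (attraction_basin S \<AA>) l M V"
begin

lemma compact_attractor: "compact \<AA>" "closed \<AA>"
  using attractor by (auto simp: attractor_in_def compact_imp_closed)

lemma attractor_filtration:
  assumes "k \<le> l"
  shows "A k \<subseteq> \<AA>" "compact (A k)" "closed (A k)" "invariant S (A k)" "positively_invariant S (A k)"
  using morse assms
  by (auto simp: morse_decomposition_def attractor_in_def compact_imp_closed invariant_imp_positively_invariant)

lemma filtration_mono: "\<lbrakk>i \<le> j; j \<le> l\<rbrakk> \<Longrightarrow> A i \<subseteq> A j"
proof (induction j rule: dec_induct)
  case (step j)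
  then have "A j \<subset> A (Suc j)"
    using morse by (auto simp: morse_decomposition_def)
  with step show ?case by auto
qed simp

lemma filtration_ends: "A 0 = {}" "A l = \<AA>"
  using morse by (auto simp: morse_decomposition_def)

lemma filtration_nonempty:
  assumes "1 \<le> k" "k \<le> l"
  shows "A k \<noteq> {}"
proof -
  have "A 0 \<subset> A (Suc 0)"
    using morse assms by (auto simp: morse_decomposition_def)
  moreover have "A (Suc 0) \<subseteq> A k"
    using assms by (intro filtration_mono) auto
  ultimately show ?thesis by auto
qed

lemma morse_set: "j \<in> {1..l} \<Longrightarrow> M j = A j \<inter> dual_repeller S \<AA> (A (j - 1))"
  using morse by (auto simp: morse_decomposition_def)

lemma morse_set_subset: "j \<in> {1..l} \<Longrightarrow> M j \<subseteq> A j"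
  using morse_set by blast

text \<open>\<open>A j\<close> is invariant, and moving along an orbit creates no new omega-limit
  points that could meet \<open>A (j - 1)\<close>.\<close>

lemma morse_set_positively_invariant:
  assumes j: "j \<in> {1..l}"
  shows "positively_invariant S (M j)"
proof -
  have "S t x \<in> M j" if t: "0 \<le> t" and x: "x \<in> M j" for t x
  proof -
    have "S t x \<in> A j"
      using x t j morse_set_subset [OF j] by (intro positively_invariantD [OF attractor_filtration(5)]) auto
    moreover from this have "S t x \<in> \<AA>"
      using attractor_filtration(1) [of j] j by auto
    moreover have "omega_limit S (S t x) \<inter> A (j - 1) = {}"
      using x omega_limit_shift [OF semiflow t, of x] by (auto simp: morse_set [OF j] dual_repeller_def)
    ultimately show ?thesis
      by (simp add: morse_set [OF j] dual_repeller_def)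
  qed
  then show ?thesis
    by (auto simp: positively_invariant_def)
qed

lemma morse_set_value: "\<lbrakk>j \<in> {1..l}; x \<in> M j\<rbrakk> \<Longrightarrow> V x = critical_value V M j"
proof -
  assume "j \<in> {1..l}" and x: "x \<in> M j"
  then have "V constant_on M j"
    using lyapunov by (auto simp: strict_morse_lyapunov_def morse_lyapunov_def)
  with x have "V ` M j = {V x}"
    by (force simp: constant_on_def)
  then show "V x = critical_value V M j"
    by (simp add: critical_value_def)
qed

lemma critical_value_mono: "\<lbrakk>i \<in> {1..l}; j \<in> {1..l}; i \<le> j\<rbrakk> \<Longrightarrow> critical_value V M i \<le> critical_value V M j"
  using lyapunov unfolding strict_morse_lyapunov_def
  by (metis order_le_less strict_mono_onD)

section \<open>The Lyapunov function along trajectories\<close>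

lemma continuous_lyapunov: "continuous_on (attraction_basin S \<AA>) V"
  using lyapunov by (auto simp: strict_morse_lyapunov_def morse_lyapunov_def)

lemma lyapunov_strict_decreasing:
  assumes "x \<in> attraction_basin S \<AA> - (\<Union>k\<in>{1..l}. M k)" "0 \<le> s" "s < t"
  shows "V (S t x) < V (S s x)"
  using lyapunov assms by (auto simp: strict_morse_lyapunov_def morse_lyapunov_def monotone_on_def)

lemma basin_positively_invariant: "positively_invariant S (attraction_basin S \<AA>)"
  by (rule attraction_basin_positively_invariant [OF semiflow])

text \<open>An orbit that starts in a Morse set stays there, where \<open>V\<close> is constant;
  every other orbit decreases strictly.\<close>

lemma lyapunov_decreasing:
  assumes x: "x \<in> attraction_basin S \<AA>" and "0 \<le> s" "s \<le> t"
  shows "V (S t x) \<le> V (S s x)"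
proof (cases "x \<in> (\<Union>k\<in>{1..l}. M k)")
  case True
  then obtain j where j: "j \<in> {1..l}" "x \<in> M j"
    by auto
  then have "S t x \<in> M j" "S s x \<in> M j"
    using positively_invariantD [OF morse_set_positively_invariant] assms by auto
  then show ?thesis
    using morse_set_value [OF j(1)] by simp
next
  case False
  with assms show ?thesis
    using lyapunov_strict_decreasing [of x s t] by (cases "s = t") auto
qed

lemma attractor_subset_basin: "\<AA> \<noteq> {} \<Longrightarrow> \<AA> \<subseteq> interior (attraction_basin S \<AA>)"
  by (rule attractor_subset_interior_basin [OF attractor])

text \<open>Omega-limit points lie in the attractor, hence in the basin, where \<open>V\<close> is
  continuous.\<close>

lemma lyapunov_limit:
  assumes x: "x \<in> attraction_basin S \<AA>" and y: "y \<in> omega_limit S x"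
  obtains t where "\<And>n::nat. 0 \<le> t n" "filterlim t at_top sequentially" "(\<lambda>n. V (S (t n) x)) \<longlonglongrightarrow> V y"
proof -
  obtain t where t: "\<And>n. 0 \<le> t n" "filterlim t at_top sequentially" "(\<lambda>n. S (t n) x) \<longlonglongrightarrow> y"
    using y by (auto simp: omega_limit_def)
  have "\<AA> \<noteq> {}"
    using x by (auto simp: attraction_basin_def)
  then have "y \<in> attraction_basin S \<AA>"
    using omega_limit_subset [OF compact_attractor(2) x] y attractor_subset_basin interior_subset by blast
  then have "(\<lambda>n. V (S (t n) x)) \<longlonglongrightarrow> V y"
    using t(1) positively_invariantD [OF basin_positively_invariant x]
    by (intro continuous_on_tendsto_compose [OF continuous_lyapunov t(3)]) auto
  with t that show thesis by blast
qed

lemma lyapunov_ge_omega_limit: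
  assumes x: "x \<in> attraction_basin S \<AA>" and y: "y \<in> omega_limit S x" and s: "0 \<le> s"
  shows "V y \<le> V (S s x)"
proof -
  obtain t where t: "filterlim t at_top sequentially" "(\<lambda>n::nat. V (S (t n) x)) \<longlonglongrightarrow> V y"
    using lyapunov_limit [OF x y] by metis
  have "\<forall>\<^sub>F n in sequentially. s \<le> t n"
    using t(1) by (simp add: filterlim_at_top)
  then have "\<forall>\<^sub>F n in sequentially. V (S (t n) x) \<le> V (S s x)"
    by eventually_elim (use lyapunov_decreasing [OF x s] in auto)
  then show ?thesis
    by (intro tendsto_upperbound [OF t(2)]) auto
qed

text \<open>\<open>V y\<close> bounds \<open>V\<close> from below along the whole trajectory, hence
  also in the limit \<open>V z\<close>. Exchanging \<open>y\<close> and \<open>z\<close> gives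
  equality.\<close>

lemma lyapunov_constant_on_omega_limit:
  assumes x: "x \<in> attraction_basin S \<AA>" and y: "y \<in> omega_limit S x" and z: "z \<in> omega_limit S x"
  shows "V y \<le> V z"
proof -
  obtain t where t: "\<And>n::nat. 0 \<le> t n" "(\<lambda>n::nat. V (S (t n) x)) \<longlonglongrightarrow> V z"
    using lyapunov_limit [OF x z] by metis
  show ?thesis
    using lyapunov_ge_omega_limit [OF x y t(1)] by (intro tendsto_lowerbound [OF t(2)]) auto
qed

text \<open>LaSalle's principle: \<open>V\<close> is constant on \<open>omega_limit S x\<close>, but strictly decreasing
  along trajectories outside the Morse sets.\<close>

lemma omega_limit_subset_morse_sets:
  assumes x: "x \<in> attraction_basin S \<AA>"
  shows "omega_limit S x \<subseteq> (\<Union>k\<in>{1..l}. M k)"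
proof
  fix y
  assume y: "y \<in> omega_limit S x"
  have "\<AA> \<noteq> {}"
    using x by (auto simp: attraction_basin_def)
  then have "y \<in> attraction_basin S \<AA>"
    using omega_limit_subset [OF compact_attractor(2) x] y attractor_subset_basin interior_subset by blast
  have "S 0 y = y"
    using semiflow by (simp add: semiflow_def)
  \<comment> \<open>The omega-limit set is positively invariant, so \<open>V\<close> cannot drop
    between \<open>y\<close> and \<open>S 1 y\<close>.\<close>
  moreover have "S 1 y \<in> omega_limit S x"
    using omega_limit_semiflow [OF semiflow y] by simp
  then have "V y \<le> V (S 1 y)"
    by (rule lyapunov_constant_on_omega_limit [OF x y])
  ultimately show "y \<in> (\<Union>k\<in>{1..l}. M k)"
    using lyapunov_strict_decreasing [of y 0 1] \<open>y \<in> attraction_basin S \<AA>\<close> by fastforce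
qed

text \<open>For \<open>k < j\<close> the point would lie in the closed positively invariant set
  \<open>A (j - 1)\<close> together with its nonempty omega-limit set, which the dual repeller
  forbids.\<close>

lemma morse_set_index_le:
  assumes k: "k \<le> l" and j: "j \<in> {1..l}" and x: "x \<in> A k \<inter> M j"
  shows "j \<le> k"
proof (rule ccontr)
  assume "\<not> j \<le> k"
  then have j': "k \<le> j - 1" "j - 1 \<le> l"
    using j by auto
  with filtration_mono x have x': "x \<in> A (j - 1)"
    by blast
  have "\<AA> \<noteq> {}" "x \<in> \<AA>"
    using attractor_filtration(1) [OF k] x by auto
  then have "x \<in> attraction_basin S \<AA>"
    using attractor_subset_basin interior_subset by blast
  then have "omega_limit S x \<noteq> {}"
    using omega_limit_nonempty [OF compact_attractor(1)] by blast
  moreover have "omega_limit S x \<subseteq> A (j - 1)"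
    by (rule closed_positively_invariant_omega_limit [OF attractor_filtration(3,5) [OF j'(2)] x'])
  moreover have "omega_limit S x \<inter> A (j - 1) = {}"
    using x by (auto simp: morse_set [OF j] dual_repeller_def)
  ultimately show False by blast
qed

text \<open>A maximum point of \<open>V\<close> on \<open>A k\<close> has a preimage under \<open>S 1\<close> in \<open>A k\<close>, at which \<open>V\<close> is not
  larger; hence it lies in a Morse set.\<close>

lemma lyapunov_le_critical_value:
  assumes k: "1 \<le> k" "k \<le> l" and x: "x \<in> A k"
  shows "V x \<le> critical_value V M k"
proof -
  have "A k \<subseteq> attraction_basin S \<AA>"
    using attractor_filtration(1) [OF k(2)] attractor_subset_basin interior_subset x by blast
  then have "continuous_on (A k) V"
    by (rule continuous_on_subset [OF continuous_lyapunov])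
  then obtain z where z: "z \<in> A k" "\<And>y. y \<in> A k \<Longrightarrow> V y \<le> V z"
    using continuous_attains_sup [OF attractor_filtration(2) [OF k(2)]] x by blast
  have "S 1 ` A k = A k"
    using attractor_filtration(4) [OF k(2)] by (simp add: invariant_def)
  then obtain y where y: "y \<in> A k" "z = S 1 y"
    using z(1) by blast
  have "y \<in> (\<Union>k\<in>{1..l}. M k)"
    using lyapunov_strict_decreasing [of y 0 1] z(2) [OF y(1)] y \<open>A k \<subseteq> attraction_basin S \<AA>\<close> semiflow
    by (fastforce simp: semiflow_def)
  then obtain j where j: "j \<in> {1..l}" "y \<in> M j"
    by blast
  \<comment> \<open>The Morse set of \<open>y\<close> contains \<open>z\<close> as well; as it meets
    \<open>A k\<close>, its index is at most \<open>k\<close>.\<close>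
  then have "z \<in> M j"
    using positively_invariantD [OF morse_set_positively_invariant] y(2) by auto
  then have "V z = critical_value V M j" "j \<le> k"
    using morse_set_value [OF j(1)] morse_set_index_le [OF k(2) j(1)] z(1) by auto
  then show ?thesis
    using z(2) [OF x] critical_value_mono [OF j(1), of k] k by auto
qed

section \<open>Sublevel sets as neighborhoods inside basins\<close>

lemma sublevel_positively_invariant: "positively_invariant S (sublevel (attraction_basin S \<AA>) V r)"
proof -
  have "S t x \<in> sublevel (attraction_basin S \<AA>) V r" if "0 \<le> t" "x \<in> sublevel (attraction_basin S \<AA>) V r" for t x
    using lyapunov_decreasing [of x 0 t] positively_invariantD [OF basin_positively_invariant, of x t]
      that semiflow by (auto simp: sublevel_def semiflow_def)
  then show ?thesis
    by (auto simp: positively_invariant_def)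
qed

text \<open>By LaSalle, omega-limit points lie in Morse sets of value at most \<open>r\<close>,
  hence of index at most \<open>k\<close>, and these are contained in \<open>A k\<close>. For
  \<open>k = 0\<close> the basin of the empty set is empty, so the sublevel set is empty
  too.\<close>

lemma sublevel_subset_basin:
  assumes k: "k \<le> l" and r: "\<And>j. \<lbrakk>j \<in> {1..l}; critical_value V M j \<le> r\<rbrakk> \<Longrightarrow> j \<le> k"
  shows "sublevel (attraction_basin S \<AA>) V r \<subseteq> attraction_basin S (A k)"
proof
  fix x
  assume "x \<in> sublevel (attraction_basin S \<AA>) V r"
  then have x: "x \<in> attraction_basin S \<AA>" "V x \<le> r"
    by (auto simp: sublevel_def)
  have "omega_limit S x \<subseteq> A k"
  proof
    fix y
    assume y: "y \<in> omega_limit S x"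
    then obtain j where j: "j \<in> {1..l}" "y \<in> M j"
      using omega_limit_subset_morse_sets [OF x(1)] by blast
    have "V y \<le> V (S 0 x)"
      using lyapunov_ge_omega_limit [OF x(1) y] by simp
    then have "critical_value V M j \<le> r"
      using x(2) semiflow morse_set_value [OF j] by (simp add: semiflow_def)
    then have "j \<le> k"
      by (rule r [OF j(1)])
    then show "y \<in> A k"
      using filtration_mono [of j k] k morse_set_subset [OF j(1)] j(2) by blast
  qed
  then show "x \<in> attraction_basin S (A k)"
    by (rule omega_limit_subset_imp_basin [OF compact_attractor(1) x(1)])
qed

text \<open>On \<open>A k\<close> the function stays at or below the critical value, hence strictly
  below \<open>r\<close>, and this strict inequality is an open condition inside the basin.\<close>

lemma filtration_subset_interior_sublevel:
  assumes k: "k \<le> l" and r: "1 \<le> k \<Longrightarrow> critical_value V M k < r"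
  shows "A k \<subseteq> interior (sublevel (attraction_basin S \<AA>) V r)"
proof (cases "k = 0")
  case False
  have "open (interior (attraction_basin S \<AA>) \<inter> V -` {..<r})"
    using continuous_on_subset [OF continuous_lyapunov interior_subset]
    by (intro continuous_open_preimage) auto
  moreover have "interior (attraction_basin S \<AA>) \<inter> V -` {..<r} \<subseteq> sublevel (attraction_basin S \<AA>) V r"
    using interior_subset by (auto simp: sublevel_def)
  ultimately have "interior (attraction_basin S \<AA>) \<inter> V -` {..<r} \<subseteq> interior (sublevel (attraction_basin S \<AA>) V r)"
    by (intro interior_maximal)
  moreover have "A k \<subseteq> interior (attraction_basin S \<AA>)"
    using attractor_filtration(1) [OF k] filtration_nonempty [of k] k False attractor_subset_basin by auto
  moreover have "A k \<subseteq> V -` {..<r}"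
    using lyapunov_le_critical_value [of k] r k False by fastforce
  ultimately show ?thesis by blast
qed (simp add: filtration_ends)

end

text \<open>The function \<open>V\<close> and the levels \<open>a\<close>, \<open>b\<close> are
  arbitrary, so the isomorphism covers every representative of the critical group.\<close>

theorem theorem6p5:
  fixes S :: "real \<Rightarrow> 'a::complete_space \<Rightarrow> 'a"
    and \<AA> :: "'a set" and l :: nat
    and A M :: "nat \<Rightarrow> 'a set"
    and k :: nat and W\<^sub>k W\<^sub>k\<^sub>1 :: "'a set"
    and V :: "'a \<Rightarrow> real" and a b :: real
    and q :: nat
  assumes "semiflow S" and "asymptotically_compact S"
    and "attractor S \<AA>"
    and "morse_decomposition S \<AA> l A M"
    and "1 \<le> k" and "k \<le> l"
    and "W\<^sub>k \<subseteq> attraction_basin S (A k)"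
    and "positively_invariant S W\<^sub>k" and "neighborhood W\<^sub>k (A k)"
    and "W\<^sub>k\<^sub>1 \<subseteq> attraction_basin S (A (k - 1))"
    and "positively_invariant S W\<^sub>k\<^sub>1" and "neighborhood W\<^sub>k\<^sub>1 (A (k - 1))"
    and "strict_morse_lyapunov S (attraction_basin S \<AA>) l M V"
    and "isolates_critical_value V l M k a b"
  shows "critical_group TYPE('g::ab_group_add) q (attraction_basin S \<AA>) V a b
           \<cong> coeff_homology_group TYPE('g) q (top_of_set W\<^sub>k) W\<^sub>k\<^sub>1"
proof -
  note morse_flow = assms(1,3,4,13)
  note filtration = attractor_filtration(2) [OF morse_flow]
  define Va where "Va = sublevel (attraction_basin S \<AA>) V a"
  define Vb where "Vb = sublevel (attraction_basin S \<AA>) V b"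
  have ab: "a < critical_value V M k" "critical_value V M k < b" and iso: "critical_value V M ` {1..l} \<inter> {a..b} = {critical_value V M k}"
    using assms(14) by (auto simp: isolates_critical_value_def)
  have less: "critical_value V M i < critical_value V M j" if "i \<in> {1..l}" "j \<in> {1..l}" "i < j" for i j
    using assms(13) that by (auto simp: strict_morse_lyapunov_def strict_mono_on_def)
  \<comment> \<open>Strictness makes the critical values distinct, so isolation keeps every value
    except the one of index \<open>k\<close> out of the whole interval.\<close>
  have outside: "critical_value V M j < a \<or> b < critical_value V M j" if "j \<in> {1..l}" "j \<noteq> k" for j
  proof -
    have "critical_value V M j \<noteq> critical_value V M k"
      using less [of j k] less [of k j] that assms(5,6) by (cases j k rule: linorder_cases) auto
    then show ?thesis
      using iso that(1) by fastforce
  qed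
  have b_le: "j \<le> k" if j: "j \<in> {1..l}" "critical_value V M j \<le> b" for j
    using outside [of j] less [of k j] ab j assms(5,6) by (cases "j \<le> k") fastforce+
  have a_le: "j \<le> k - 1" if j: "j \<in> {1..l}" "critical_value V M j \<le> a" for j
    using less [of k j] ab j assms(5,6) by (cases j k rule: linorder_cases) auto
  \<comment> \<open>For \<open>k = 1\<close> the set \<open>A (k - 1)\<close> is empty and has no
    critical value, hence the premise.\<close>
  have a_gt: "critical_value V M (k - 1) < a" if "1 \<le> k - 1"
  proof -
    have "k - 1 \<in> {1..l}" "k \<in> {1..l}" "k - 1 < k"
      using that assms(5,6) by auto
    then show ?thesis
      using outside [of "k - 1"] less [of "k - 1" k] ab(2) by fastforce
  qed
  have k1: "k - 1 \<le> l"
    using assms(6) by simp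
  have Vb: "positively_invariant S Vb" "Vb \<subseteq> attraction_basin S (A k)" "A k \<subseteq> interior Vb"
  proof -
    show "positively_invariant S Vb"
      unfolding Vb_def by (rule sublevel_positively_invariant [OF morse_flow])
    show "Vb \<subseteq> attraction_basin S (A k)"
      unfolding Vb_def by (rule sublevel_subset_basin [OF morse_flow assms(6)]) (rule b_le)
    show "A k \<subseteq> interior Vb"
      unfolding Vb_def by (rule filtration_subset_interior_sublevel [OF morse_flow assms(6)]) (rule ab(2))
  qed
  have Va: "positively_invariant S Va" "Va \<subseteq> attraction_basin S (A (k - 1))" "A (k - 1) \<subseteq> interior Va"
  proof -
    show "positively_invariant S Va"
      unfolding Va_def by (rule sublevel_positively_invariant [OF morse_flow])
    show "Va \<subseteq> attraction_basin S (A (k - 1))"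
      unfolding Va_def by (rule sublevel_subset_basin [OF morse_flow k1]) (rule a_le)
    show "A (k - 1) \<subseteq> interior Va"
      unfolding Va_def by (rule filtration_subset_interior_sublevel [OF morse_flow k1]) (rule a_gt)
  qed
  have W: "A k \<subseteq> interior W\<^sub>k" "A (k - 1) \<subseteq> interior W\<^sub>k\<^sub>1"
    using assms(9,12) closure_subset unfolding neighborhood_iff by blast+
  have A_mono: "A (k - 1) \<subseteq> A k"
    using assms(6) by (intro filtration_mono [OF morse_flow]) auto
  define P where "P = W\<^sub>k \<inter> Vb"
  \<comment> \<open>\<open>W\<^sub>k\<^sub>1\<close> need not lie in \<open>W\<^sub>k\<close>;
    intersecting with \<open>P\<close> makes \<open>(P, Q)\<close> a pair.\<close>
  define Q where "Q = P \<inter> (W\<^sub>k\<^sub>1 \<inter> Va)"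
  have P: "positively_invariant S P" "A k \<subseteq> interior P"
    unfolding P_def using W Vb assms(8) by (auto intro: positively_invariant_Int)
  \<comment> \<open>The inclusion of \<open>A (k - 1)\<close> in \<open>A k\<close> places it in the
    interior of \<open>P\<close>, besides those of \<open>W\<^sub>k\<^sub>1\<close> and
    \<open>Va\<close>.\<close>
  have Q: "positively_invariant S Q" "A (k - 1) \<subseteq> interior Q"
    unfolding Q_def using P W Va assms(11) A_mono by (auto intro: positively_invariant_Int)
  have "coeff_homology_group TYPE('g) q (top_of_set P) Q \<cong> coeff_homology_group TYPE('g) q (top_of_set Vb) Va"
    by (rule coeff_homology_iso_absorbed [OF assms(1) Vb(1) Va(1) P(1) Q(1), where A = "A k" and B = "A (k - 1)"])
       (use P Q Va Vb filtration k1 assms(6) in \<open>auto simp: P_def Q_def\<close>)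
  moreover have "coeff_homology_group TYPE('g) q (top_of_set P) Q \<cong> coeff_homology_group TYPE('g) q (top_of_set W\<^sub>k) W\<^sub>k\<^sub>1"
    by (rule coeff_homology_iso_absorbed [OF assms(1) assms(8,11) P(1) Q(1), where A = "A k" and B = "A (k - 1)"])
       (use P Q assms(7,10) filtration k1 assms(6) in \<open>auto simp: P_def Q_def\<close>)
  ultimately show ?thesis
    unfolding critical_group_def Va_def Vb_def
    using group.iso_sym [OF group_coeff_homology_group] iso_trans by blast
qed

end
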